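(* Fix a prime $p > 2$ and a positive integer $M$. Let $\#_{all}(n)$ be the number of all groups of order $p^n$ (up to isomorphism), and let $\#_{B_0 \geq M}(n)$ be the number of those groups $G$ of order $p^n$ (up to isomorphism) whose Bogomolov multiplier $B_0(G)$ is of order at least $M$. Then $$\lim_{n \to \infty} \frac{\log_p \#_{B_0 \geq M}(n)}{\log_p \#_{all}(n)} = 1.$$
   Context: For a finite group $G$, the Bogomolov multiplier of $G$ is $$B_0(G) = \bigcap_{A \leq G,\ [A,A]=1} \ker\left( \mathrm{res}^G_A \colon H^2(G, \mathbb{Q}/\mathbb{Z}) \to H^2(A, \mathbb{Q}/\mathbb{Z}) \right),$$ the intersection running over all abelian subgroups $A$ of $G$ (trivial action on $\mathbb{Q}/\mathbb{Z}$). *)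

theory Defs
  imports Complex_Main "HOL-Algebra.Algebra"
begin

section \<open>The coefficient group \<open>\<rat>/\<int>\<close>\<close>

definition rat_group :: "rat monoid"
  where "rat_group = \<lparr>carrier = UNIV, monoid.mult = (+), one = 0\<rparr>"

definition QmodZ :: "rat set monoid"
  where "QmodZ = rat_group Mod \<int>"

lemma comm_group_rat_group: "comm_group rat_group"
proof (rule comm_groupI)
  fix x assume "x \<in> carrier rat_group"
  show "\<exists>y \<in> carrier rat_group. y \<otimes>\<^bsub>rat_group\<^esub> x = \<one>\<^bsub>rat_group\<^esub>"
    by (rule bexI[of _ "- x"]) (auto simp: rat_group_def)
qed (auto simp: rat_group_def)

lemma inv_rat_group [simp]: "inv\<^bsub>rat_group\<^esub> x = - x"
proof (rule group.inv_equality)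
  show "Group.group rat_group"
    using comm_group_rat_group by (simp add: comm_group_def)
qed (auto simp: rat_group_def)

lemma comm_group_QmodZ: "comm_group QmodZ"
  unfolding QmodZ_def
proof (rule comm_group.abelian_FactGroup [OF comm_group_rat_group])
  show "subgroup \<int> rat_group"
    by (rule group.subgroupI)
      (use comm_group_rat_group in \<open>auto simp: comm_group_def rat_group_def Ints_add\<close>,
       use inv_rat_group in \<open>simp add: rat_group_def\<close>)
qed


section \<open>Second cohomology with trivial action\<close>

text \<open>
  \<open>H\<^sup>2(G, A)\<close> is computed from the inhomogeneous standard complex, where \<open>A\<close> is an abelian
  group (written multiplicatively) on which \<open>G\<close> acts trivially.  Cochains are extensional
  functions, so that they form the groups \<open>product_group\<close> of the library.
\<close>

definition cochains1 :: "('a, 'c) monoid_scheme \<Rightarrow> ('b, 'd) monoid_scheme \<Rightarrow> ('a \<Rightarrow> 'b) monoid"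
  where "cochains1 G A = product_group (carrier G) (\<lambda>_. A)"

definition cochains2 ::
    "('a, 'c) monoid_scheme \<Rightarrow> ('b, 'd) monoid_scheme \<Rightarrow> ('a \<times> 'a \<Rightarrow> 'b) monoid"
  where "cochains2 G A = product_group (carrier G \<times> carrier G) (\<lambda>_. A)"

definition cochains3 ::
    "('a, 'c) monoid_scheme \<Rightarrow> ('b, 'd) monoid_scheme \<Rightarrow> ('a \<times> 'a \<times> 'a \<Rightarrow> 'b) monoid"
  where "cochains3 G A = product_group (carrier G \<times> carrier G \<times> carrier G) (\<lambda>_. A)"

definition coboundary1 ::
    "('a, 'c) monoid_scheme \<Rightarrow> ('b, 'd) monoid_scheme \<Rightarrow> ('a \<Rightarrow> 'b) \<Rightarrow> 'a \<times> 'a \<Rightarrow> 'b"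
  where "coboundary1 G A c =
    (\<lambda>(g, h) \<in> carrier G \<times> carrier G. c h \<otimes>\<^bsub>A\<^esub> inv\<^bsub>A\<^esub> c (g \<otimes>\<^bsub>G\<^esub> h) \<otimes>\<^bsub>A\<^esub> c g)"

definition coboundary2 ::
    "('a, 'c) monoid_scheme \<Rightarrow> ('b, 'd) monoid_scheme \<Rightarrow> ('a \<times> 'a \<Rightarrow> 'b) \<Rightarrow> 'a \<times> 'a \<times> 'a \<Rightarrow> 'b"
  where "coboundary2 G A f =
    (\<lambda>(g, h, k) \<in> carrier G \<times> carrier G \<times> carrier G.
       f (h, k) \<otimes>\<^bsub>A\<^esub> inv\<^bsub>A\<^esub> f (g \<otimes>\<^bsub>G\<^esub> h, k)
         \<otimes>\<^bsub>A\<^esub> f (g, h \<otimes>\<^bsub>G\<^esub> k) \<otimes>\<^bsub>A\<^esub> inv\<^bsub>A\<^esub> f (g, h))"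

definition cocycles2 ::
    "('a, 'c) monoid_scheme \<Rightarrow> ('b, 'd) monoid_scheme \<Rightarrow> ('a \<times> 'a \<Rightarrow> 'b) monoid"
  where "cocycles2 G A =
    (cochains2 G A)\<lparr>carrier := kernel (cochains2 G A) (cochains3 G A) (coboundary2 G A)\<rparr>"

definition coboundaries2 ::
    "('a, 'c) monoid_scheme \<Rightarrow> ('b, 'd) monoid_scheme \<Rightarrow> ('a \<times> 'a \<Rightarrow> 'b) set"
  where "coboundaries2 G A = coboundary1 G A ` carrier (cochains1 G A)"

definition H2 ::
    "('a, 'c) monoid_scheme \<Rightarrow> ('b, 'd) monoid_scheme \<Rightarrow> ('a \<times> 'a \<Rightarrow> 'b) set monoid"
  where "H2 G A = cocycles2 G A Mod coboundaries2 G A"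

text \<open>
  Restriction to the subgroup with carrier \<open>S\<close>.  A cohomology class \<open>U\<close> is a coset, i.e. a set of
  cocycles; the classes of the restrictions of its members all coincide
  (lemma \<open>res2_class\<close> below), which justifies \<open>the_elem\<close>.
\<close>

definition res2 ::
    "('a, 'c) monoid_scheme \<Rightarrow> 'a set \<Rightarrow> ('b, 'd) monoid_scheme
      \<Rightarrow> ('a \<times> 'a \<Rightarrow> 'b) set \<Rightarrow> ('a \<times> 'a \<Rightarrow> 'b) set"
  where "res2 G S A U = the_elem
    ((\<lambda>f. coboundaries2 (G\<lparr>carrier := S\<rparr>) A
            #>\<^bsub>cocycles2 (G\<lparr>carrier := S\<rparr>) A\<^esub> restrict f (S \<times> S)) ` U)"


section \<open>The Bogomolov multiplier\<close>

definition bogomolov_multiplier :: "('a, 'c) monoid_scheme \<Rightarrow> ('a \<times> 'a \<Rightarrow> rat set) set set"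
  where "bogomolov_multiplier G =
    (\<Inter>S \<in> {S. subgroup S G \<and> comm_group (G\<lparr>carrier := S\<rparr>)}.
       kernel (H2 G QmodZ) (H2 (G\<lparr>carrier := S\<rparr>) QmodZ) (res2 G S QmodZ))"


section \<open>Counting groups up to isomorphism\<close>

text \<open>
  Every finite group is isomorphic to one whose carrier is a set of natural numbers
  (lemma \<open>finite_group_iso_nat\<close> below), so isomorphism classes of finite groups are counted
  within the type \<open>nat monoid\<close>.
\<close>

definition num_iso_classes :: "nat monoid set \<Rightarrow> nat"
  where "num_iso_classes \<G> = card (\<G> // {(G, H). G \<in> \<G> \<and> H \<in> \<G> \<and> G \<cong> H})"

definition groups_of_order :: "nat \<Rightarrow> nat monoid set"
  where "groups_of_order m = {G. Group.group G \<and> finite (carrier G) \<and> order G = m}"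

definition num_all :: "nat \<Rightarrow> nat \<Rightarrow> nat"
  where "num_all p n = num_iso_classes (groups_of_order (p ^ n))"

definition num_B0_ge :: "nat \<Rightarrow> nat \<Rightarrow> nat \<Rightarrow> nat"
  where "num_B0_ge p M n =
    num_iso_classes {G \<in> groups_of_order (p ^ n). card (bogomolov_multiplier G) \<ge> M}"


section \<open>Well-definedness\<close>

lemma equiv_iso_classes:
  assumes "\<And>G. G \<in> \<G> \<Longrightarrow> Group.group G"
  shows "equiv \<G> {(G, H). G \<in> \<G> \<and> H \<in> \<G> \<and> G \<cong> H}"
  unfolding equiv_def
proof (intro conjI)
  show "{(G, H). G \<in> \<G> \<and> H \<in> \<G> \<and> G \<cong> H} \<subseteq> \<G> \<times> \<G>"
    by auto
  show "refl_on \<G> {(G, H). G \<in> \<G> \<and> H \<in> \<G> \<and> G \<cong> H}"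
    by (auto simp: refl_on_def iso_refl)
  show "sym {(G, H). G \<in> \<G> \<and> H \<in> \<G> \<and> G \<cong> H}"
    by (auto simp: sym_def assms group.iso_sym)
  show "trans {(G, H). G \<in> \<G> \<and> H \<in> \<G> \<and> G \<cong> H}"
    by (auto simp: trans_def intro: iso_trans)
qed

lemma finite_group_iso_nat:
  fixes G :: "'a monoid"
  assumes G: "Group.group G" and fin: "finite (carrier G)"
  shows "\<exists>H \<in> groups_of_order (order G). G \<cong> H"
proof -
  interpret Group.group G by (fact G)
  obtain h where h: "bij_betw h (carrier G) {0..<order G}"
    using ex_bij_betw_finite_nat[OF fin] by (auto simp: order_def)
  define k where "k = inv_into (carrier G) h"
  define H where "H = \<lparr>carrier = {0..<order G}, monoid.mult = (\<lambda>x y. h (k x \<otimes>\<^bsub>G\<^esub> k y)), one = h \<one>\<^bsub>G\<^esub>\<rparr>"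
  have kh: "k (h x) = x" if "x \<in> carrier G" for x
    using h that by (auto simp: k_def bij_betw_def)
  have "h \<in> hom G H"
    using h by (auto simp: hom_def H_def kh bij_betw_def)
  moreover have "bij_betw h (carrier G) (carrier H)"
    using h by (simp add: H_def)
  ultimately have iso: "h \<in> iso G H"
    by (simp add: iso_def)
  have "Group.group (H\<lparr>one := h \<one>\<^bsub>G\<^esub>\<rparr>)"
    by (rule iso_imp_img_group[OF iso])
  moreover have "H\<lparr>one := h \<one>\<^bsub>G\<^esub>\<rparr> = H"
    by (simp add: H_def)
  ultimately have "H \<in> groups_of_order (order G)"
    by (simp add: groups_of_order_def) (simp add: H_def order_def)
  thus ?thesis
    using iso is_isoI by blast
qed

context
  fixes G :: "('a, 'c) monoid_scheme" and A :: "('b, 'd) monoid_scheme"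
  assumes G: "Group.group G" and A: "comm_group A"
begin

interpretation G: Group.group G by (fact G)
interpretation A: comm_group A by (fact A)

lemma comm_group_cochains2: "comm_group (cochains2 G A)"
proof (rule group.group_comm_groupI)
  show "Group.group (cochains2 G A)"
    by (simp add: cochains2_def)
qed (auto simp: cochains2_def intro!: restrict_ext A.m_comm)

lemma group_cochains3: "Group.group (cochains3 G A)"
  by (simp add: cochains3_def)

lemma group_cochains1: "Group.group (cochains1 G A)"
  by (simp add: cochains1_def)

lemma alternating_mult:
  assumes "a \<in> carrier A" "b \<in> carrier A" "c \<in> carrier A"
    and "a' \<in> carrier A" "b' \<in> carrier A" "c' \<in> carrier A"
  shows "(a \<otimes>\<^bsub>A\<^esub> a') \<otimes>\<^bsub>A\<^esub> inv\<^bsub>A\<^esub> (b \<otimes>\<^bsub>A\<^esub> b') \<otimes>\<^bsub>A\<^esub> (c \<otimes>\<^bsub>A\<^esub> c') =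
    (a \<otimes>\<^bsub>A\<^esub> inv\<^bsub>A\<^esub> b \<otimes>\<^bsub>A\<^esub> c) \<otimes>\<^bsub>A\<^esub> (a' \<otimes>\<^bsub>A\<^esub> inv\<^bsub>A\<^esub> b' \<otimes>\<^bsub>A\<^esub> c')"
  using assms by (simp add: A.inv_mult A.m_ac)

lemma alternating_mult4:
  assumes "a \<in> carrier A" "b \<in> carrier A" "c \<in> carrier A" "d \<in> carrier A"
    and "a' \<in> carrier A" "b' \<in> carrier A" "c' \<in> carrier A" "d' \<in> carrier A"
  shows "(a \<otimes>\<^bsub>A\<^esub> a') \<otimes>\<^bsub>A\<^esub> inv\<^bsub>A\<^esub> (b \<otimes>\<^bsub>A\<^esub> b') \<otimes>\<^bsub>A\<^esub> (c \<otimes>\<^bsub>A\<^esub> c') \<otimes>\<^bsub>A\<^esub> inv\<^bsub>A\<^esub> (d \<otimes>\<^bsub>A\<^esub> d') =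
    (a \<otimes>\<^bsub>A\<^esub> inv\<^bsub>A\<^esub> b \<otimes>\<^bsub>A\<^esub> c \<otimes>\<^bsub>A\<^esub> inv\<^bsub>A\<^esub> d) \<otimes>\<^bsub>A\<^esub> (a' \<otimes>\<^bsub>A\<^esub> inv\<^bsub>A\<^esub> b' \<otimes>\<^bsub>A\<^esub> c' \<otimes>\<^bsub>A\<^esub> inv\<^bsub>A\<^esub> d')"
  using assms by (simp add: A.inv_mult A.m_ac)

lemma cochains2_closed:
  "f \<in> carrier (cochains2 G A) \<Longrightarrow> g \<in> carrier G \<Longrightarrow> h \<in> carrier G \<Longrightarrow> f (g, h) \<in> carrier A"
  by (auto simp: cochains2_def PiE_def Pi_def)

lemma cochains1_closed:
  "f \<in> carrier (cochains1 G A) \<Longrightarrow> g \<in> carrier G \<Longrightarrow> f g \<in> carrier A"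
  by (auto simp: cochains1_def PiE_def Pi_def)

lemma coboundary2_hom: "coboundary2 G A \<in> hom (cochains2 G A) (cochains3 G A)"
proof (rule homI)
  fix f assume f: "f \<in> carrier (cochains2 G A)"
  show "coboundary2 G A f \<in> carrier (cochains3 G A)"
    using cochains2_closed[OF f] by (auto simp: cochains3_def coboundary2_def)
next
  fix f f' assume f: "f \<in> carrier (cochains2 G A)" "f' \<in> carrier (cochains2 G A)"
  show "coboundary2 G A (f \<otimes>\<^bsub>cochains2 G A\<^esub> f') =
        coboundary2 G A f \<otimes>\<^bsub>cochains3 G A\<^esub> coboundary2 G A f'"
    using cochains2_closed[OF f(1)] cochains2_closed[OF f(2)]
    by (auto simp: cochains2_def cochains3_def coboundary2_def fun_eq_iff alternating_mult4)
qed

lemma coboundary1_hom: "coboundary1 G A \<in> hom (cochains1 G A) (cochains2 G A)"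
proof (rule homI)
  fix f assume f: "f \<in> carrier (cochains1 G A)"
  show "coboundary1 G A f \<in> carrier (cochains2 G A)"
    using cochains1_closed[OF f] by (auto simp: cochains2_def coboundary1_def)
next
  fix f f' assume f: "f \<in> carrier (cochains1 G A)" "f' \<in> carrier (cochains1 G A)"
  show "coboundary1 G A (f \<otimes>\<^bsub>cochains1 G A\<^esub> f') =
        coboundary1 G A f \<otimes>\<^bsub>cochains2 G A\<^esub> coboundary1 G A f'"
    using cochains1_closed[OF f(1)] cochains1_closed[OF f(2)]
    by (auto simp: cochains1_def cochains2_def coboundary1_def fun_eq_iff alternating_mult)
qed

lemma coboundary2_coboundary1:
  assumes c: "c \<in> carrier (cochains1 G A)"
  shows "coboundary2 G A (coboundary1 G A c) = \<one>\<^bsub>cochains3 G A\<^esub>"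
proof -
  have *: "a3 \<otimes>\<^bsub>A\<^esub> inv\<^bsub>A\<^esub> b \<otimes>\<^bsub>A\<^esub> a2 \<otimes>\<^bsub>A\<^esub> inv\<^bsub>A\<^esub> (a3 \<otimes>\<^bsub>A\<^esub> inv\<^bsub>A\<^esub> d \<otimes>\<^bsub>A\<^esub> e)
      \<otimes>\<^bsub>A\<^esub> (b \<otimes>\<^bsub>A\<^esub> inv\<^bsub>A\<^esub> d \<otimes>\<^bsub>A\<^esub> a1) \<otimes>\<^bsub>A\<^esub> inv\<^bsub>A\<^esub> (a2 \<otimes>\<^bsub>A\<^esub> inv\<^bsub>A\<^esub> e \<otimes>\<^bsub>A\<^esub> a1) = \<one>\<^bsub>A\<^esub>"
    if "a1 \<in> carrier A" "a2 \<in> carrier A" "a3 \<in> carrier A" "b \<in> carrier A" "d \<in> carrier A"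
       "e \<in> carrier A" for a1 a2 a3 b d e
  proof -
    have regroup: "a3 \<otimes>\<^bsub>A\<^esub> b' \<otimes>\<^bsub>A\<^esub> a2 \<otimes>\<^bsub>A\<^esub> (a3' \<otimes>\<^bsub>A\<^esub> d \<otimes>\<^bsub>A\<^esub> e')
        \<otimes>\<^bsub>A\<^esub> (b \<otimes>\<^bsub>A\<^esub> d' \<otimes>\<^bsub>A\<^esub> a1) \<otimes>\<^bsub>A\<^esub> (a2' \<otimes>\<^bsub>A\<^esub> e \<otimes>\<^bsub>A\<^esub> a1') =
      (a3 \<otimes>\<^bsub>A\<^esub> a3') \<otimes>\<^bsub>A\<^esub> (b \<otimes>\<^bsub>A\<^esub> b') \<otimes>\<^bsub>A\<^esub> (a2 \<otimes>\<^bsub>A\<^esub> a2') \<otimes>\<^bsub>A\<^esub> (d \<otimes>\<^bsub>A\<^esub> d')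
        \<otimes>\<^bsub>A\<^esub> (e \<otimes>\<^bsub>A\<^esub> e') \<otimes>\<^bsub>A\<^esub> (a1 \<otimes>\<^bsub>A\<^esub> a1')"
      if "a1' \<in> carrier A" "a2' \<in> carrier A" "a3' \<in> carrier A" "b' \<in> carrier A" "d' \<in> carrier A"
         "e' \<in> carrier A" for a1' a2' a3' b' d' e'
      using that \<open>a1 \<in> carrier A\<close> \<open>a2 \<in> carrier A\<close> \<open>a3 \<in> carrier A\<close> \<open>b \<in> carrier A\<close>
        \<open>d \<in> carrier A\<close> \<open>e \<in> carrier A\<close>
      by (simp add: A.m_ac)
    show ?thesis
      using that by (simp add: A.inv_mult regroup)
  qed
  show ?thesis
    using cochains1_closed[OF c]
    by (auto simp: cochains3_def coboundary2_def coboundary1_def fun_eq_iff G.m_assoc *)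
qed

lemma comm_group_cocycles2: "comm_group (cocycles2 G A)"
proof -
  interpret C: comm_group "cochains2 G A" by (fact comm_group_cochains2)
  interpret d2: group_hom "cochains2 G A" "cochains3 G A" "coboundary2 G A"
    using coboundary2_hom group_cochains3
    by (intro group_hom.intro group_hom_axioms.intro C.is_group) auto
  show ?thesis
    unfolding cocycles2_def
  proof (rule group.group_comm_groupI)
    show "Group.group ((cochains2 G A)
        \<lparr>carrier := kernel (cochains2 G A) (cochains3 G A) (coboundary2 G A)\<rparr>)"
      by (rule C.subgroup_imp_group[OF d2.subgroup_kernel])
  qed (simp add: kernel_def C.m_comm)
qed

lemma subgroup_coboundaries2: "subgroup (coboundaries2 G A) (cocycles2 G A)"
proof -
  interpret C: comm_group "cochains2 G A" by (fact comm_group_cochains2)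
  interpret d2: group_hom "cochains2 G A" "cochains3 G A" "coboundary2 G A"
    using coboundary2_hom group_cochains3
    by (intro group_hom.intro group_hom_axioms.intro C.is_group) auto
  interpret d1: group_hom "cochains1 G A" "cochains2 G A" "coboundary1 G A"
    using coboundary1_hom group_cochains1
    by (intro group_hom.intro group_hom_axioms.intro C.is_group) auto
  have "subgroup (coboundaries2 G A) (cochains2 G A)"
    unfolding coboundaries2_def by (rule d1.img_is_subgroup)
  moreover have "coboundaries2 G A \<subseteq> kernel (cochains2 G A) (cochains3 G A) (coboundary2 G A)"
    using coboundary2_coboundary1 d1.hom_closed by (auto simp: coboundaries2_def kernel_def)
  ultimately show ?thesis
    unfolding cocycles2_def by (intro C.subgroup_incl d2.subgroup_kernel)
qed

lemma comm_group_H2: "comm_group (H2 G A)"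
  unfolding H2_def
  by (rule comm_group.abelian_FactGroup[OF comm_group_cocycles2 subgroup_coboundaries2])

end

context
  fixes G :: "('a, 'c) monoid_scheme" and A :: "('b, 'd) monoid_scheme" and S :: "'a set"
  assumes G: "Group.group G" and A: "comm_group A" and S: "subgroup S G"
begin

interpretation G: Group.group G by (fact G)
interpretation A: comm_group A by (fact A)

lemma group_S: "Group.group (G\<lparr>carrier := S\<rparr>)"
  using S by (rule G.subgroup_imp_group)

lemma S_subset: "S \<subseteq> carrier G"
  using S by (rule subgroup.subset)

lemma restrict_cocycle_hom:
  "(\<lambda>f. restrict f (S \<times> S)) \<in> hom (cocycles2 G A) (cocycles2 (G\<lparr>carrier := S\<rparr>) A)"
proof (rule homI)
  fix f assume f: "f \<in> carrier (cocycles2 G A)"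
  have fc: "f \<in> carrier (cochains2 G A)" and d: "coboundary2 G A f = \<one>\<^bsub>cochains3 G A\<^esub>"
    using f by (auto simp: cocycles2_def kernel_def)
  have "restrict f (S \<times> S) \<in> carrier (cochains2 (G\<lparr>carrier := S\<rparr>) A)"
    using cochains2_closed[OF G A fc] S_subset by (auto simp: cochains2_def)
  moreover have "coboundary2 (G\<lparr>carrier := S\<rparr>) A (restrict f (S \<times> S)) =
      \<one>\<^bsub>cochains3 (G\<lparr>carrier := S\<rparr>) A\<^esub>"
  proof
    fix x :: "'a \<times> 'a \<times> 'a"
    obtain g h k where x: "x = (g, h, k)" by (cases x)
    show "coboundary2 (G\<lparr>carrier := S\<rparr>) A (restrict f (S \<times> S)) x =
      \<one>\<^bsub>cochains3 (G\<lparr>carrier := S\<rparr>) A\<^esub> x"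
      using fun_cong[OF d, of x] S_subset subgroup.m_closed[OF S]
      by (auto simp: x coboundary2_def cochains3_def subset_iff split: if_splits)
  qed
  ultimately show "restrict f (S \<times> S) \<in> carrier (cocycles2 (G\<lparr>carrier := S\<rparr>) A)"
    by (simp add: cocycles2_def kernel_def)
next
  fix f f' assume "f \<in> carrier (cocycles2 G A)" "f' \<in> carrier (cocycles2 G A)"
  show "restrict (f \<otimes>\<^bsub>cocycles2 G A\<^esub> f') (S \<times> S) =
    restrict f (S \<times> S) \<otimes>\<^bsub>cocycles2 (G\<lparr>carrier := S\<rparr>) A\<^esub> restrict f' (S \<times> S)"
    using S_subset by (auto simp: cocycles2_def cochains2_def fun_eq_iff)
qed

lemma restrict_coboundary:
  assumes "b \<in> coboundaries2 G A"
  shows "restrict b (S \<times> S) \<in> coboundaries2 (G\<lparr>carrier := S\<rparr>) A"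
proof -
  obtain c where c: "c \<in> carrier (cochains1 G A)" and b: "b = coboundary1 G A c"
    using assms by (auto simp: coboundaries2_def)
  have "restrict c S \<in> carrier (cochains1 (G\<lparr>carrier := S\<rparr>) A)"
    using cochains1_closed[OF G A c] S_subset by (auto simp: cochains1_def)
  moreover have "restrict b (S \<times> S) = coboundary1 (G\<lparr>carrier := S\<rparr>) A (restrict c S)"
    using S_subset subgroup.m_closed[OF S] by (auto simp: b coboundary1_def fun_eq_iff)
  ultimately show ?thesis
    unfolding coboundaries2_def by blast
qed

lemma res2_class:
  assumes f: "f \<in> carrier (cocycles2 G A)"
  shows "res2 G S A (coboundaries2 G A #>\<^bsub>cocycles2 G A\<^esub> f) =
    coboundaries2 (G\<lparr>carrier := S\<rparr>) A #>\<^bsub>cocycles2 (G\<lparr>carrier := S\<rparr>) A\<^esub> restrict f (S \<times> S)"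
proof -
  let ?H = "G\<lparr>carrier := S\<rparr>"
  let ?cl = "\<lambda>f. coboundaries2 ?H A #>\<^bsub>cocycles2 ?H A\<^esub> restrict f (S \<times> S)"
  interpret Z: comm_group "cocycles2 G A" by (rule comm_group_cocycles2[OF G A])
  interpret ZH: comm_group "cocycles2 ?H A" by (rule comm_group_cocycles2[OF group_S A])
  have B: "subgroup (coboundaries2 G A) (cocycles2 G A)"
    by (rule subgroup_coboundaries2[OF G A])
  have BH: "subgroup (coboundaries2 ?H A) (cocycles2 ?H A)"
    by (rule subgroup_coboundaries2[OF group_S A])
  have eq: "?cl f' = ?cl f" if f': "f' \<in> coboundaries2 G A #>\<^bsub>cocycles2 G A\<^esub> f" for f'
  proof -
    obtain b where b: "b \<in> coboundaries2 G A" and f'_eq: "f' = b \<otimes>\<^bsub>cocycles2 G A\<^esub> f"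
      using f' by (auto simp: r_coset_def)
    have bZ: "b \<in> carrier (cocycles2 G A)"
      by (rule subgroup.mem_carrier[OF B b])
    have r: "restrict f' (S \<times> S) =
        restrict b (S \<times> S) \<otimes>\<^bsub>cocycles2 ?H A\<^esub> restrict f (S \<times> S)"
      unfolding f'_eq by (rule hom_mult[OF restrict_cocycle_hom bZ f])
    have rf: "restrict f (S \<times> S) \<in> carrier (cocycles2 ?H A)"
      by (rule hom_in_carrier[OF restrict_cocycle_hom f])
    have "restrict f' (S \<times> S) \<in> coboundaries2 ?H A #>\<^bsub>cocycles2 ?H A\<^esub> restrict f (S \<times> S)"
      using r restrict_coboundary[OF b] by (auto simp: r_coset_def)
    thus ?thesis
      using ZH.repr_independence[OF _ rf BH] by simp
  qed
  have "f \<in> coboundaries2 G A #>\<^bsub>cocycles2 G A\<^esub> f"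
    by (rule Z.rcos_self[OF f B])
  hence "?cl ` (coboundaries2 G A #>\<^bsub>cocycles2 G A\<^esub> f) = {?cl f}"
    using eq by blast
  thus ?thesis
    by (simp add: res2_def)
qed

lemma res2_hom: "res2 G S A \<in> hom (H2 G A) (H2 (G\<lparr>carrier := S\<rparr>) A)"
proof (rule homI)
  let ?H = "G\<lparr>carrier := S\<rparr>"
  interpret Z: comm_group "cocycles2 G A" by (rule comm_group_cocycles2[OF G A])
  interpret ZH: comm_group "cocycles2 ?H A" by (rule comm_group_cocycles2[OF group_S A])
  interpret B: normal "coboundaries2 G A" "cocycles2 G A"
    using Z.normal_iff_subgroup subgroup_coboundaries2[OF G A] by blast
  interpret BH: normal "coboundaries2 ?H A" "cocycles2 ?H A"
    using ZH.normal_iff_subgroup subgroup_coboundaries2[OF group_S A] by blast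
  note rc = hom_in_carrier[OF restrict_cocycle_hom]
  {
    fix U assume "U \<in> carrier (H2 G A)"
    then obtain f where "f \<in> carrier (cocycles2 G A)"
        "U = coboundaries2 G A #>\<^bsub>cocycles2 G A\<^esub> f"
      by (auto simp: H2_def carrier_FactGroup)
    thus "res2 G S A U \<in> carrier (H2 ?H A)"
      using rc by (auto simp: res2_class H2_def carrier_FactGroup)
  next
    fix U V assume "U \<in> carrier (H2 G A)" "V \<in> carrier (H2 G A)"
    then obtain f f' where f: "f \<in> carrier (cocycles2 G A)" "f' \<in> carrier (cocycles2 G A)"
        and UV: "U = coboundaries2 G A #>\<^bsub>cocycles2 G A\<^esub> f"
          "V = coboundaries2 G A #>\<^bsub>cocycles2 G A\<^esub> f'"
      by (auto simp: H2_def carrier_FactGroup)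
    show "res2 G S A (U \<otimes>\<^bsub>H2 G A\<^esub> V) = res2 G S A U \<otimes>\<^bsub>H2 ?H A\<^esub> res2 G S A V"
      using f by (simp add: UV H2_def B.rcos_sum BH.rcos_sum res2_class rc
          hom_mult[OF restrict_cocycle_hom])
  }
qed

lemma subgroup_kernel_res2: "subgroup (kernel (H2 G A) (H2 (G\<lparr>carrier := S\<rparr>) A) (res2 G S A)) (H2 G A)"
  using comm_group_H2[OF G A] comm_group_H2[OF group_S A] res2_hom
  by (intro group_hom.subgroup_kernel group_hom.intro group_hom_axioms.intro)
    (auto simp: comm_group_def)

end

lemma subgroup_bogomolov_multiplier:
  assumes G: "Group.group G"
  shows "subgroup (bogomolov_multiplier G) (H2 G QmodZ)"
proof -
  interpret Group.group G by (fact G)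
  have "subgroup {\<one>\<^bsub>G\<^esub>} G" "comm_group (G\<lparr>carrier := {\<one>\<^bsub>G\<^esub>}\<rparr>)"
    by (rule triv_subgroup) (rule group.group_comm_groupI[OF subgroup_imp_group[OF triv_subgroup]], simp)
  hence ne: "{S. subgroup S G \<and> comm_group (G\<lparr>carrier := S\<rparr>)} \<noteq> {}"
    by blast
  have H: "Group.group (H2 G QmodZ)"
    using comm_group_H2[OF G comm_group_QmodZ] by (simp add: comm_group_def)
  show ?thesis
    unfolding bogomolov_multiplier_def
  proof (rule group.subgroups_Inter[OF H])
    fix K assume "K \<in> (\<lambda>S. kernel (H2 G QmodZ) (H2 (G\<lparr>carrier := S\<rparr>) QmodZ) (res2 G S QmodZ)) `
      {S. subgroup S G \<and> comm_group (G\<lparr>carrier := S\<rparr>)}"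
    then obtain S where "subgroup S G"
        and "K = kernel (H2 G QmodZ) (H2 (G\<lparr>carrier := S\<rparr>) QmodZ) (res2 G S QmodZ)"
      by blast
    thus "subgroup K (H2 G QmodZ)"
      using subgroup_kernel_res2[OF G comm_group_QmodZ] by simp
  qed (simp only: image_is_empty ne not_False_eq_True)
qed

end

theory Submission
  imports Defs "HOL-Number_Theory.Cong"
begin

text \<open>
  On the logarithmic scale the products \<open>G \<times> H\<close> already account for all groups of \<open>p\<close>-power order,
  where \<open>H\<close>, \<open>|H| = p\<^sup>c\<close>, is one fixed group whose Bogomolov multiplier has at least \<open>M\<close> elements.  Write
  \<open>A(n)\<close> and \<open>B(n)\<close> for the logarithms of the two counts.  Three facts give the limit.

  The map \<open>G \<mapsto> G \<times> H\<close> sends groups of order \<open>p\<^sup>n\<close> to groups of order \<open>p\<^sup>n\<^sup>+\<^sup>c\<close> with large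
  multiplier, because classes inflate from \<open>H\<close>.  Since \<open>G\<close> can be read off from \<open>G \<times> H\<close> and the
  embedding of \<open>H\<close> (\<open>iso_if_DirProd_iso\<close>), at most \<open>|G \<times> H|\<close> to the power \<open>|H|\<close> groups \<open>G\<close> share a
  product, so \<open>A(n) \<le> B(n + c) + O(n)\<close> (\<open>num_all_le_num_B0_ge\<close>).

  The shift by \<open>c\<close> is harmless because \<open>A\<close> is large but grows slowly.  A group of order \<open>p\<^sup>n\<^sup>+\<^sup>1\<close> is determined by a subgroup of index \<open>p\<close> and a multiplication table of a
  transversal with \<open>O(n)\<close> generators, whence \<open>A(n + 1) \<le> A(n) + O(n\<^sup>2)\<close> (\<open>num_all_Suc_le\<close>).
  Counting bilinear maps between two halves of the generators with values in a centre gives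
  \<open>A(n) \<ge> n\<^sup>3/250\<close> for large \<open>n\<close> (\<open>num_all_lower_bound\<close>, \<open>log_num_all_ge_cube\<close>).  Altogether
  \<open>A(n) - O(n\<^sup>2) \<le> B(n) \<le> A(n)\<close>, and dividing by the cubic \<open>A(n)\<close> finishes the proof.

  The factor \<open>H\<close> is a class two group over \<open>\<int>/q\<^sup>2\<close>, \<open>q = p\<^sup>M\<close>, on four generators with the single
  relation \<open>[e\<^sub>0, e\<^sub>1] [e\<^sub>2, e\<^sub>3] = 1\<close> among the commutators.  This is Bogomolov's mechanism: the
  relation is not a product of relations coming from commuting pairs.  If \<open>x\<close> and \<open>y\<close> commute,
  then the Pluecker relation gives \<open>p\<^sub>0\<^sub>1\<^sup>2 = 0\<close> modulo \<open>q\<^sup>2\<close>, so \<open>q\<close> divides \<open>p\<^sub>0\<^sub>1\<close>.  Hence the cocycles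
  \<open>j x\<^sub>0 y\<^sub>1 / q\<close> become symmetric, and therefore trivial, on every abelian subgroup, while the
  relation keeps their \<open>q\<close> classes apart (\<open>card_bogomolov_ge\<close>).
\<close>

section \<open>Counting isomorphism classes\<close>

abbreviation iso_rel :: "nat monoid set \<Rightarrow> (nat monoid \<times> nat monoid) set"
  where "iso_rel \<G> \<equiv> {(G, H). G \<in> \<G> \<and> H \<in> \<G> \<and> G \<cong> H}"

text \<open>
  All the counting below goes through this principle: \<open>P K d i\<close> says that the datum \<open>d\<close> on the
  group \<open>K\<close> determines the object \<open>i\<close>, so \<open>b\<close> bounds the overcounting.  The data are taken on a
  chosen representative of an isomorphism class, hence have to exist on every representative.
\<close>
lemma card_le_num_iso_classes:
  assumes grp: "\<And>K. K \<in> \<H> \<Longrightarrow> Group.group K"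
    and fin: "finite (\<H> // iso_rel \<H>)"
    and D: "\<And>K. K \<in> \<H> \<Longrightarrow> finite (D K) \<and> card (D K) \<le> b"
    and ex: "\<And>i. i \<in> I \<Longrightarrow> \<exists>K\<in>\<H>. \<forall>K'\<in>\<H>. K \<cong> K' \<longrightarrow> (\<exists>d\<in>D K'. P K' d i)"
    and inj: "\<And>K d i j. K \<in> \<H> \<Longrightarrow> d \<in> D K \<Longrightarrow> i \<in> I \<Longrightarrow> j \<in> I \<Longrightarrow> P K d i \<Longrightarrow> P K d j \<Longrightarrow> i = j"
  shows "finite I \<and> card I \<le> num_iso_classes \<H> * b"
proof -
  let ?Q = "\<H> // iso_rel \<H>"
  have eq: "equiv \<H> (iso_rel \<H>)" by (rule equiv_iso_classes[OF grp])
  define rep where "rep C = (SOME K. K \<in> C)" for C :: "nat monoid set"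
  have rep: "rep C \<in> C \<and> rep C \<in> \<H>" if "C \<in> ?Q" for C
  proof -
    have "\<exists>K. K \<in> C" using in_quotient_imp_non_empty[OF eq that] by blast
    then have "rep C \<in> C" unfolding rep_def by (rule someI_ex)
    then show ?thesis using in_quotient_imp_subset[OF eq that] by blast
  qed
  let ?X = "SIGMA C:?Q. D (rep C)"
  have finX: "finite ?X" using fin rep D by (intro finite_SigmaI) auto
  have "card ?X = (\<Sum>C\<in>?Q. card (D (rep C)))"
    using fin rep D by (intro card_SigmaI) auto
  also have "\<dots> \<le> card ?Q * b"
    using sum_bounded_above[of ?Q "\<lambda>C. card (D (rep C))" b] rep D by auto
  finally have cX: "card ?X \<le> num_iso_classes \<H> * b" by (simp add: num_iso_classes_def)
  have "\<forall>i\<in>I. \<exists>x\<in>?X. P (rep (fst x)) (snd x) i"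
  proof
    fix i assume "i \<in> I"
    from ex[OF this] obtain K where K: "K \<in> \<H>"
      and data: "\<And>K'. K' \<in> \<H> \<Longrightarrow> K \<cong> K' \<Longrightarrow> \<exists>d\<in>D K'. P K' d i" by blast
    let ?C = "iso_rel \<H> `` {K}"
    have C: "?C \<in> ?Q" using K by (rule quotientI)
    have "K \<cong> rep ?C" using rep[OF C] by blast
    then obtain d where "d \<in> D (rep ?C)" "P (rep ?C) d i" using data rep[OF C] by blast
    then show "\<exists>x\<in>?X. P (rep (fst x)) (snd x) i" using C by (intro bexI[of _ "(?C, d)"]) auto
  qed
  then have "\<forall>i\<in>I. \<exists>x. x \<in> ?X \<and> P (rep (fst x)) (snd x) i" by blast
  from bchoice[OF this] obtain f
    where f: "\<forall>i\<in>I. f i \<in> ?X \<and> P (rep (fst (f i))) (snd (f i)) i" by (rule exE)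
  have "inj_on f I"
  proof (rule inj_onI)
    fix i j assume ij: "i \<in> I" "j \<in> I" "f i = f j"
    show "i = j"
    proof (rule inj)
      show "rep (fst (f i)) \<in> \<H>" "snd (f i) \<in> D (rep (fst (f i)))"
        using bspec[OF f ij(1)] rep by auto
    qed (use ij f in auto)
  qed
  moreover have "f ` I \<subseteq> ?X" using f by blast
  ultimately have "finite I" "card I \<le> card ?X"
    using finX by (auto intro: inj_on_finite card_inj_on_le)
  with cX show ?thesis by simp
qed

lemma num_iso_classes_le:
  assumes grpG: "\<And>G. G \<in> \<G> \<Longrightarrow> Group.group G"
    and grp: "\<And>K. K \<in> \<H> \<Longrightarrow> Group.group K"
    and fin: "finite (\<H> // iso_rel \<H>)"
    and D: "\<And>K. K \<in> \<H> \<Longrightarrow> finite (D K) \<and> card (D K) \<le> b"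
    and ex: "\<And>G. G \<in> \<G> \<Longrightarrow> \<exists>K\<in>\<H>. \<forall>K'\<in>\<H>. K \<cong> K' \<longrightarrow> (\<exists>d\<in>D K'. P K' d G)"
    and inj: "\<And>K d G G'. K \<in> \<H> \<Longrightarrow> d \<in> D K \<Longrightarrow> G \<in> \<G> \<Longrightarrow> G' \<in> \<G> \<Longrightarrow> P K d G \<Longrightarrow> P K d G' \<Longrightarrow> G \<cong> G'"
  shows "finite (\<G> // iso_rel \<G>) \<and> num_iso_classes \<G> \<le> num_iso_classes \<H> * b"
  unfolding num_iso_classes_def[of \<G>]
proof (rule card_le_num_iso_classes[where D = D and P = "\<lambda>K d C. \<exists>G\<in>C. P K d G"])
  have eq: "equiv \<G> (iso_rel \<G>)" by (rule equiv_iso_classes[OF grpG])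
  fix C assume C: "C \<in> \<G> // iso_rel \<G>"
  then obtain G where G: "G \<in> C" using in_quotient_imp_non_empty[OF eq] by blast
  then have "G \<in> \<G>" using in_quotient_imp_subset[OF eq C] by blast
  from ex[OF this] G show "\<exists>K\<in>\<H>. \<forall>K'\<in>\<H>. K \<cong> K' \<longrightarrow> (\<exists>d\<in>D K'. \<exists>G\<in>C. P K' d G)" by meson
next
  have eq: "equiv \<G> (iso_rel \<G>)" by (rule equiv_iso_classes[OF grpG])
  fix K d C C' assume K: "K \<in> \<H>" "d \<in> D K" and C: "C \<in> \<G> // iso_rel \<G>" "C' \<in> \<G> // iso_rel \<G>"
    and "\<exists>G\<in>C. P K d G" "\<exists>G\<in>C'. P K d G"
  then obtain G G' where G: "G \<in> C" "G' \<in> C'" "P K d G" "P K d G'" by blast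
  then have "G \<in> \<G>" "G' \<in> \<G>" using in_quotient_imp_subset[OF eq] C by blast+
  then have "(G, G') \<in> iso_rel \<G>" using inj K G by blast
  then show "C = C'" using quotient_eq_iff[OF eq C G(1,2)] by blast
qed (use grp fin D in auto)


section \<open>Generators and extension of maps\<close>

lemma subgroup_psubset_card:
  assumes G: "Group.group G" and fin: "finite (carrier G)"
    and H: "subgroup H G" and K: "subgroup K G" and HK: "H \<subset> K"
  shows "2 * card H \<le> card K"
proof -
  interpret Group.group G by (fact G)
  interpret K: Group.group "G\<lparr>carrier := K\<rparr>" by (rule subgroup_imp_group[OF K])
  have "subgroup H (G\<lparr>carrier := K\<rparr>)" using subgroup_incl[OF H K] HK by blast
  from K.lagrange[OF this] have dvd: "card H dvd card K" by (simp add: order_def) (metis dvd_triv_right)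
  have "finite K" using fin subgroup.subset[OF K] finite_subset by blast
  then have less: "card H < card K" using HK by (rule psubset_card_mono)
  obtain c where c: "card K = card H * c" using dvd by blast
  have "c \<noteq> 0" "c \<noteq> 1" using less c by auto
  then have "2 \<le> c" by linarith
  then show ?thesis using c by (simp add: mult.commute)
qed

text \<open>
  A maximal set \<open>T\<close> with \<open>2 ^ card T \<le> card (generate G T)\<close> works: if it did not generate, a
  further element would at least double the subgroup and so preserve the inequality.
\<close>
lemma ex_small_generating_set:
  assumes G: "Group.group G" and fin: "finite (carrier G)"
  shows "\<exists>T\<subseteq>carrier G. generate G T = carrier G \<and> 2 ^ card T \<le> order G"
proof -
  interpret Group.group G by (fact G)
  let ?\<T> = "{T. T \<subseteq> carrier G \<and> 2 ^ card T \<le> card (generate G T)}"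
  have "finite ?\<T>" using fin by (auto intro: finite_subset[of _ "Pow (carrier G)"])
  moreover have "{} \<in> ?\<T>" by (simp add: generate_empty)
  ultimately have "\<exists>T\<in>?\<T>. {} \<subseteq> T \<and> (\<forall>U\<in>?\<T>. T \<subseteq> U \<longrightarrow> T = U)" by (rule finite_has_maximal2)
  then obtain T where T: "T \<in> ?\<T>" and max: "\<forall>U\<in>?\<T>. T \<subseteq> U \<longrightarrow> T = U" by (elim bexE conjE)
  have sub: "subgroup (generate G U) G" if "U \<subseteq> carrier G" for U
    using generate_is_subgroup[OF that] .
  have "generate G T = carrier G"
  proof (rule ccontr)
    assume ne: "generate G T \<noteq> carrier G"
    have "generate G T \<subseteq> carrier G" using T generate_in_carrier by blast
    then obtain x where x: "x \<in> carrier G" "x \<notin> generate G T" using ne by blast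
    let ?U = "insert x T"
    have U: "?U \<subseteq> carrier G" using x T by blast
    have "x \<in> generate G ?U" by (rule generate.incl) simp
    then have "generate G T \<subset> generate G ?U" using mono_generate[of T ?U] x by blast
    then have "2 * card (generate G T) \<le> card (generate G ?U)"
      using subgroup_psubset_card[OF G fin] sub U T by blast
    moreover have "x \<notin> T" using x generate.incl by metis
    moreover have "finite T" using T fin finite_subset by blast
    ultimately have "?U \<in> ?\<T>" using T U by simp
    then have "T = ?U" using max by blast
    then show False using \<open>x \<notin> T\<close> by blast
  qed
  then show ?thesis using T by (auto simp: order_def)
qed

lemma hom_eq_on_generate:
  assumes G: "Group.group G" and H: "Group.group H" and f: "f \<in> hom G H" and g: "g \<in> hom G H"
    and T: "T \<subseteq> carrier G" and eq: "\<And>t. t \<in> T \<Longrightarrow> f t = g t" and x: "x \<in> generate G T"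
  shows "f x = g x"
proof -
  interpret f: group_hom G H f using G H f by (simp add: group_hom_def group_hom_axioms_def)
  interpret g: group_hom G H g using G H g by (simp add: group_hom_def group_hom_axioms_def)
  show ?thesis using x
  proof induction
    case (eng x y)
    then show ?case using group.generate_in_carrier[OF G T] by simp
  qed (use eq T in auto)
qed

text \<open>
  The elements \<open>y\<close> with \<open>f (x y) = f x f y\<close> for all \<open>x\<close> form a subgroup.
\<close>
lemma hom_if_right_mult_generators:
  assumes G: "Group.group G" and H: "Group.group H" and f: "f \<in> carrier G \<rightarrow> carrier H"
    and T: "T \<subseteq> carrier G" and gen: "generate G T = carrier G"
    and mult: "\<And>x t. x \<in> carrier G \<Longrightarrow> t \<in> T \<Longrightarrow> f (x \<otimes>\<^bsub>G\<^esub> t) = f x \<otimes>\<^bsub>H\<^esub> f t"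
    and one: "f \<one>\<^bsub>G\<^esub> = \<one>\<^bsub>H\<^esub>"
  shows "f \<in> hom G H"
proof -
  interpret G: Group.group G by (fact G)
  interpret H: Group.group H by (fact H)
  have fc: "f x \<in> carrier H" if "x \<in> carrier G" for x using f that by blast
  have "f (x \<otimes>\<^bsub>G\<^esub> y) = f x \<otimes>\<^bsub>H\<^esub> f y" if y: "y \<in> generate G T" and x: "x \<in> carrier G" for x y
    using y x
  proof (induction arbitrary: x)
    case one
    then show ?case using assms(7) fc by simp
  next
    case (incl t)
    then show ?case using mult by simp
  next
    case (inv t)
    have t: "t \<in> carrier G" using inv T by blast
    have *: "f (x \<otimes>\<^bsub>G\<^esub> inv\<^bsub>G\<^esub> t) = f x \<otimes>\<^bsub>H\<^esub> inv\<^bsub>H\<^esub> f t" if x: "x \<in> carrier G" for x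
    proof -
      have "f x = f (x \<otimes>\<^bsub>G\<^esub> inv\<^bsub>G\<^esub> t) \<otimes>\<^bsub>H\<^esub> f t"
        using mult[OF _ inv(1), of "x \<otimes>\<^bsub>G\<^esub> inv\<^bsub>G\<^esub> t"] x t by (simp add: G.m_assoc)
      then show ?thesis using x t fc by (simp add: H.m_assoc)
    qed
    from *[of "\<one>\<^bsub>G\<^esub>"] have "f (inv\<^bsub>G\<^esub> t) = inv\<^bsub>H\<^esub> f t" using t fc one by simp
    then show ?case using *[OF inv(2)] by simp
  next
    case (eng y z)
    have yz: "y \<in> carrier G" "z \<in> carrier G" using eng(1,2) gen by auto
    have "f (x \<otimes>\<^bsub>G\<^esub> (y \<otimes>\<^bsub>G\<^esub> z)) = f ((x \<otimes>\<^bsub>G\<^esub> y) \<otimes>\<^bsub>G\<^esub> z)" using eng yz by (simp add: G.m_assoc)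
    also have "\<dots> = f x \<otimes>\<^bsub>H\<^esub> f y \<otimes>\<^bsub>H\<^esub> f z" using eng yz by simp
    also have "\<dots> = f x \<otimes>\<^bsub>H\<^esub> f (y \<otimes>\<^bsub>G\<^esub> z)" using eng yz fc by (simp add: H.m_assoc)
    finally show ?case .
  qed
  then show ?thesis using gen fc by (auto intro!: homI)
qed


section \<open>Growth of the number of groups\<close>

lemma ex_transversal:
  fixes G (structure)
  assumes G: "Group.group G" and fin: "finite (carrier G)" and N: "subgroup N G"
    and index: "order G = m * card N"
  shows "\<exists>t. t \<in> {..<m} \<rightarrow> carrier G \<and> t 0 = \<one> \<and>
    bij_betw (\<lambda>(x, i). x \<otimes> t i) (N \<times> {..<m}) (carrier G)"
proof -
  interpret Group.group G by (fact G)
  interpret N: subgroup N G by (fact N)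
  have finN: "finite N" using fin N.subset finite_subset by blast
  then have posN: "card N > 0" using N.one_closed card_gt_0_iff by blast
  then have cos: "card (rcosets N) = m" using lagrange[OF N] index by simp
  have finC: "finite (rcosets N)" using fin by (auto simp: RCOSETS_def)
  have NC: "N \<in> rcosets N" using subgroup.subgroup_in_rcosets[OF N G] .
  then have m: "0 < m" using cos finC card_gt_0_iff by blast
  obtain h where h: "bij_betw h {..<m} (rcosets N)"
    using finC cos ex_bij_betw_nat_finite[of "rcosets N"] by (auto simp: lessThan_atLeast0)
  obtain i0 where i0: "i0 < m" "h i0 = N" using NC bij_betw_imp_surj_on[OF h] by (metis imageE lessThan_iff)
  define k where "k = h \<circ> Transposition.transpose 0 i0"
  have k: "bij_betw k {..<m} (rcosets N)"
    unfolding k_def using m i0(1) by (intro bij_betw_trans[OF _ h]) simp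
  have k0: "k 0 = N" by (simp add: k_def i0)
  have "\<exists>x. x \<in> carrier G \<and> k i = N #> x" if "i < m" for i
    using bij_betwE[OF k] that by (auto simp: RCOSETS_def)
  then obtain u where u: "\<And>i. i < m \<Longrightarrow> u i \<in> carrier G \<and> k i = N #> u i" by metis
  define t where "t i = (if i = 0 then \<one> else u i)" for i :: nat
  have t: "t i \<in> carrier G \<and> k i = N #> t i" if "i < m" for i
    using u[OF that] k0 by (auto simp: t_def coset_mult_one N.subset)
  have "inj_on (\<lambda>(x, i). x \<otimes> t i) (N \<times> {..<m})"
  proof (rule inj_onI, clarsimp)
    fix x i y j assume xy: "x \<in> N" "y \<in> N" and ij: "i < m" "j < m" and eq: "x \<otimes> t i = y \<otimes> t j"
    have "x \<otimes> t i \<in> N #> t i" "x \<otimes> t i \<in> N #> t j"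
      using xy by (auto simp: r_coset_def) (auto simp: eq)
    then have "N #> t i = N #> t j"
      using repr_independence[OF _ _ N] t ij by metis
    then have "i = j" using t ij bij_betw_imp_inj_on[OF k] by (auto simp: inj_on_def)
    then show "x = y \<and> i = j" using eq xy ij t by simp
  qed
  moreover have "card (N \<times> {..<m}) = card (carrier G)"
    using index by (simp add: order_def card_cartesian_product mult.commute)
  moreover have "(\<lambda>(x, i). x \<otimes> t i) ` (N \<times> {..<m}) \<subseteq> carrier G" using t by auto
  ultimately have "bij_betw (\<lambda>(x, i). x \<otimes> t i) (N \<times> {..<m}) (carrier G)"
    unfolding bij_betw_def using card_subset_eq[OF fin] by (metis card_image)
  then show ?thesis using t by (intro exI[of _ t]) (auto simp: t_def)
qed

text \<open>
  The generators \<open>T\<close> of \<open>K\<close> and the representatives \<open>t j\<close> together generate \<open>G\<close>; the sum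
  type indexes both kinds.  In the unique factorisation \<open>\<theta> x t k\<close> of \<open>t i s\<close>, where \<open>s\<close> is such a
  generator, the pair \<open>(x, k)\<close> is the table entry \<open>d (s, i)\<close>.
\<close>
definition transversal_table ::
    "('a, 'c) monoid_scheme \<Rightarrow> 'a set \<Rightarrow> nat \<Rightarrow> (('a + nat) \<times> nat \<Rightarrow> 'a \<times> nat)
      \<Rightarrow> ('b, 'd) monoid_scheme \<Rightarrow> ('a \<Rightarrow> 'b) \<Rightarrow> (nat \<Rightarrow> 'b) \<Rightarrow> bool"
  where "transversal_table K T m d G \<theta> t \<longleftrightarrow>
    \<theta> \<in> hom K G \<and> t \<in> {..<m} \<rightarrow> carrier G \<and> t 0 = \<one>\<^bsub>G\<^esub> \<and>
    bij_betw (\<lambda>(x, i). \<theta> x \<otimes>\<^bsub>G\<^esub> t i) (carrier K \<times> {..<m}) (carrier G) \<and>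
    (\<forall>s\<in>T <+> {..<m}. \<forall>i<m.
      t i \<otimes>\<^bsub>G\<^esub> case_sum \<theta> t s = \<theta> (fst (d (s, i))) \<otimes>\<^bsub>G\<^esub> t (snd (d (s, i))))"

text \<open>
  The bijection \<open>\<theta> x t i \<mapsto> \<theta>' x t' i\<close> respects right multiplication by the generators of \<open>G\<close>,
  because the common table describes that multiplication on both sides; hence it is a
  homomorphism.
\<close>
lemma transversal_table_unique:
  assumes K: "Group.group K" and T: "T \<subseteq> carrier K" and gen: "generate K T = carrier K"
    and m: "0 < m" and d: "d \<in> (T <+> {..<m}) \<times> {..<m} \<rightarrow> carrier K \<times> {..<m}"
    and G: "Group.group G" and G': "Group.group G'"
    and tab: "transversal_table K T m d G \<theta> t" and tab': "transversal_table K T m d G' \<theta>' t'"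
  shows "G \<cong> G'"
proof -
  interpret K: Group.group K by (fact K)
  interpret G: Group.group G by (fact G)
  interpret G': Group.group G' by (fact G')
  let ?X = "carrier K \<times> {..<m}"
  define e where "e = (\<lambda>(x, i). \<theta> x \<otimes>\<^bsub>G\<^esub> t i)"
  define e' where "e' = (\<lambda>(x, i). \<theta>' x \<otimes>\<^bsub>G'\<^esub> t' i)"
  define f where "f = e' \<circ> inv_into ?X e"
  have th: "\<theta> \<in> hom K G" "\<theta>' \<in> hom K G'" and t0: "t 0 = \<one>\<^bsub>G\<^esub>" "t' 0 = \<one>\<^bsub>G'\<^esub>"
    and tc: "\<And>i. i < m \<Longrightarrow> t i \<in> carrier G" "\<And>i. i < m \<Longrightarrow> t' i \<in> carrier G'"
    and e: "bij_betw e ?X (carrier G)" and e': "bij_betw e' ?X (carrier G')"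
    and step: "\<And>s i. s \<in> T <+> {..<m} \<Longrightarrow> i < m \<Longrightarrow>
      t i \<otimes>\<^bsub>G\<^esub> case_sum \<theta> t s = \<theta> (fst (d (s, i))) \<otimes>\<^bsub>G\<^esub> t (snd (d (s, i)))"
    and step': "\<And>s i. s \<in> T <+> {..<m} \<Longrightarrow> i < m \<Longrightarrow>
      t' i \<otimes>\<^bsub>G'\<^esub> case_sum \<theta>' t' s = \<theta>' (fst (d (s, i))) \<otimes>\<^bsub>G'\<^esub> t' (snd (d (s, i)))"
    using tab tab' by (auto simp: transversal_table_def e_def e'_def)
  interpret th: group_hom K G \<theta> using K G th by (simp add: group_hom_def group_hom_axioms_def)
  interpret th': group_hom K G' \<theta>' using K G' th by (simp add: group_hom_def group_hom_axioms_def)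
  have f: "bij_betw f (carrier G) (carrier G')"
    unfolding f_def by (rule bij_betw_trans[OF bij_betw_inv_into[OF e] e'])
  have fe: "f (\<theta> x \<otimes>\<^bsub>G\<^esub> t i) = \<theta>' x \<otimes>\<^bsub>G'\<^esub> t' i" if "x \<in> carrier K" "i < m" for x i
    using bij_betw_inv_into_left[OF e, of "(x, i)"] that by (simp add: f_def e_def e'_def)
  have f_th: "f (\<theta> x) = \<theta>' x" if "x \<in> carrier K" for x
    using fe[of x 0] that m t0 by simp
  have f_t: "f (t i) = t' i" if "i < m" for i
    using fe[of "\<one>\<^bsub>K\<^esub>" i] that tc by simp
  have surj: "\<exists>x i. x \<in> carrier K \<and> i < m \<and> g = \<theta> x \<otimes>\<^bsub>G\<^esub> t i" if "g \<in> carrier G" for g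
  proof -
    have "g \<in> e ` ?X" using that bij_betw_imp_surj_on[OF e] by simp
    then show ?thesis by (auto simp: e_def)
  qed
  define S where "S = case_sum \<theta> t ` (T <+> {..<m})"
  have SG: "S \<subseteq> carrier G" using T tc by (auto simp: S_def)
  have "f \<in> hom G G'"
  proof (rule hom_if_right_mult_generators[OF G G' _ SG])
    have thgen: "\<theta> x \<in> generate G S" if "x \<in> carrier K" for x
    proof -
      have "\<theta> x \<in> generate G (\<theta> ` T)" using th.generate_img[OF T] that gen by auto
      moreover have "\<theta> ` T \<subseteq> S" by (force simp: S_def)
      ultimately show ?thesis using G.mono_generate by blast
    qed
    have "carrier G \<subseteq> generate G S"
    proof
      fix g assume "g \<in> carrier G"
      then obtain x i where xi: "x \<in> carrier K" "i < m" and g: "g = \<theta> x \<otimes>\<^bsub>G\<^esub> t i"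
        using surj by blast
      have "t i \<in> S" using xi by (force simp: S_def)
      then show "g \<in> generate G S" unfolding g
        by (intro generate.eng thgen[OF xi(1)] generate.incl)
    qed
    then show "generate G S = carrier G" using G.generate_in_carrier[OF SG] by blast
    show "f \<one>\<^bsub>G\<^esub> = \<one>\<^bsub>G'\<^esub>" using f_th[of "\<one>\<^bsub>K\<^esub>"] by simp
    show "f \<in> carrier G \<rightarrow> carrier G'" using f by (auto simp: bij_betw_def)
  next
    fix g s assume gs: "g \<in> carrier G" "s \<in> S"
    obtain x i where xi: "x \<in> carrier K" "i < m" and g: "g = \<theta> x \<otimes>\<^bsub>G\<^esub> t i"
      using surj[OF gs(1)] by blast
    obtain w where w: "w \<in> T <+> {..<m}" and s: "s = case_sum \<theta> t w"
      using gs(2) by (auto simp only: S_def)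
    obtain y j where dw: "d (w, i) = (y, j)" by fastforce
    then have yj: "y \<in> carrier K" "j < m" using d w xi by force+
    have sc: "case_sum \<theta> t w \<in> carrier G" "case_sum \<theta>' t' w \<in> carrier G'"
      and fs: "f s = case_sum \<theta>' t' w"
      using w T tc f_th f_t by (auto simp: s)
    have "g \<otimes>\<^bsub>G\<^esub> s = \<theta> x \<otimes>\<^bsub>G\<^esub> (t i \<otimes>\<^bsub>G\<^esub> case_sum \<theta> t w)"
      using xi tc sc by (simp add: g s G.m_assoc)
    also have "\<dots> = \<theta> (x \<otimes>\<^bsub>K\<^esub> y) \<otimes>\<^bsub>G\<^esub> t j"
      using step[OF w xi(2)] xi yj tc by (simp add: dw G.m_assoc)
    finally have "f (g \<otimes>\<^bsub>G\<^esub> s) = \<theta>' (x \<otimes>\<^bsub>K\<^esub> y) \<otimes>\<^bsub>G'\<^esub> t' j"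
      using xi yj fe[of "x \<otimes>\<^bsub>K\<^esub> y" j] by (metis K.m_closed)
    also have "\<dots> = \<theta>' x \<otimes>\<^bsub>G'\<^esub> (t' i \<otimes>\<^bsub>G'\<^esub> case_sum \<theta>' t' w)"
      using step'[OF w xi(2)] xi yj tc by (simp add: dw G'.m_assoc)
    also have "\<dots> = f g \<otimes>\<^bsub>G'\<^esub> f s"
      using xi tc sc by (simp add: g fs fe G'.m_assoc)
    finally show "f (g \<otimes>\<^bsub>G\<^esub> s) = f g \<otimes>\<^bsub>G'\<^esub> f s" .
  qed
  then show ?thesis using f by (intro is_isoI) (simp add: iso_def)
qed

lemma groups_of_orderD:
  assumes "G \<in> groups_of_order m"
  shows "Group.group G" "finite (carrier G)" "card (carrier G) = m"
  using assms by (auto simp: groups_of_order_def order_def)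

text \<open>
  A group of order \<open>p ^ Suc n\<close> has a subgroup of index \<open>p\<close>, and a group of order \<open>p ^ n\<close> needs
  at most \<open>p * n\<close> generators because \<open>p \<le> 2 ^ p\<close>; so its table has at most \<open>(p * n + p) * p\<close>
  entries.
\<close>
lemma num_all_Suc_le:
  assumes p: "Factorial_Ring.prime (p::nat)"
    and fin: "finite (groups_of_order (p ^ n) // iso_rel (groups_of_order (p ^ n)))"
  shows "finite (groups_of_order (p ^ Suc n) // iso_rel (groups_of_order (p ^ Suc n))) \<and>
    num_all p (Suc n) \<le> num_all p n * (p ^ Suc n) ^ ((p * n + p) * p)"
  unfolding num_all_def
proof -
  have p0: "0 < p" using p prime_gt_0_nat by blast
  let ?good = "\<lambda>K T. T \<subseteq> carrier K \<and> generate K T = carrier K \<and> 2 ^ card T \<le> order K"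
  define gens where "gens K = (SOME T. ?good K T)" for K :: "nat monoid"
  have gens: "?good K (gens K)" if "K \<in> groups_of_order (p ^ n)" for K
    unfolding gens_def using ex_small_generating_set[of K] groups_of_orderD[OF that]
    by (intro someI_ex[of "?good K"]) blast
  let ?D = "\<lambda>K. (gens K <+> {..<p}) \<times> {..<p} \<rightarrow>\<^sub>E carrier K \<times> {..<p}"
  let ?P = "\<lambda>K d G. \<exists>\<theta> t. transversal_table K (gens K) p d G \<theta> t"
  show "finite (groups_of_order (p ^ Suc n) // iso_rel (groups_of_order (p ^ Suc n))) \<and>
    num_iso_classes (groups_of_order (p ^ Suc n))
      \<le> num_iso_classes (groups_of_order (p ^ n)) * (p ^ Suc n) ^ ((p * n + p) * p)"
  proof (rule num_iso_classes_le[where D = ?D and P = ?P])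
    fix K assume K: "K \<in> groups_of_order (p ^ n)"
    have finT: "finite (gens K)" using gens[OF K] groups_of_orderD(2)[OF K] finite_subset by blast
    have "(2::nat) ^ card (gens K) \<le> p ^ n"
      using gens[OF K] groups_of_orderD(3)[OF K] by (simp add: order_def)
    also have "\<dots> \<le> (2 ^ p) ^ n" by (rule power_mono) auto
    finally have "card (gens K) \<le> p * n" by (simp flip: power_mult)
    then have "card ((gens K <+> {..<p}) \<times> {..<p}) \<le> (p * n + p) * p"
      using finT by (simp add: card_cartesian_product card_Plus)
    then have "(p ^ Suc n) ^ card ((gens K <+> {..<p}) \<times> {..<p}) \<le> (p ^ Suc n) ^ ((p * n + p) * p)"
      using p0 by (intro power_increasing) auto
    moreover have "card (?D K) = (p ^ Suc n) ^ card ((gens K <+> {..<p}) \<times> {..<p})"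
      using finT groups_of_orderD(3)[OF K]
      by (simp add: card_PiE card_cartesian_product mult.commute)
    ultimately show "finite (?D K) \<and> card (?D K) \<le> (p ^ Suc n) ^ ((p * n + p) * p)"
      using finT groups_of_orderD(2)[OF K] by (auto intro!: finite_PiE)
  next
    fix G assume "G \<in> groups_of_order (p ^ Suc n)"
    note G = groups_of_orderD[OF this]
    interpret G: Group.group G by (fact G(1))
    obtain N where N: "subgroup N G" "card N = p ^ n"
      using sylow_thm[OF p G(1), of n p] G(2,3) by (auto simp: order_def)
    then have NK: "G\<lparr>carrier := N\<rparr> \<in> groups_of_order (p ^ n)"
      using G.subgroup_imp_group[OF N(1)] finite_subset[OF subgroup.subset[OF N(1)] G(2)]
      by (simp add: groups_of_order_def order_def)
    obtain t where t: "t \<in> {..<p} \<rightarrow> carrier G" "t 0 = \<one>\<^bsub>G\<^esub>"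
      and bij: "bij_betw (\<lambda>(x, i). x \<otimes>\<^bsub>G\<^esub> t i) (N \<times> {..<p}) (carrier G)"
      using ex_transversal[OF G(1,2) N(1), of p] G(3) N(2) by (auto simp: order_def)
    show "\<exists>K\<in>groups_of_order (p ^ n). \<forall>K'\<in>groups_of_order (p ^ n). K \<cong> K' \<longrightarrow>
      (\<exists>d\<in>?D K'. ?P K' d G)"
    proof (rule bexI[OF _ NK], intro ballI impI)
      fix K assume K: "K \<in> groups_of_order (p ^ n)" and "G\<lparr>carrier := N\<rparr> \<cong> K"
      then have "K \<cong> G\<lparr>carrier := N\<rparr>" using group.iso_sym groups_of_orderD(1)[OF NK] by blast
      then obtain \<theta> where "\<theta> \<in> iso K (G\<lparr>carrier := N\<rparr>)" by (auto simp: is_iso_def)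
      then have hom: "\<theta> \<in> hom K G" and bth: "bij_betw \<theta> (carrier K) N"
        using subgroup.subset[OF N(1)] by (auto simp: iso_def hom_def)
      let ?e = "\<lambda>(x, i). \<theta> x \<otimes>\<^bsub>G\<^esub> t i"
      let ?X = "carrier K \<times> {..<p}"
      have "bij_betw (map_prod \<theta> id) ?X (N \<times> {..<p})"
        using bth by (intro bij_betw_map_prod) auto
      from bij_betw_trans[OF this bij] have bije: "bij_betw ?e ?X (carrier G)"
        by (simp add: comp_def case_prod_unfold map_prod_def)
      define d where "d = (\<lambda>(s, i)\<in>(gens K <+> {..<p}) \<times> {..<p}.
        inv_into ?X ?e (t i \<otimes>\<^bsub>G\<^esub> case_sum \<theta> t s))"
      have prod: "t i \<otimes>\<^bsub>G\<^esub> case_sum \<theta> t s \<in> carrier G"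
        if "s \<in> gens K <+> {..<p}" "i < p" for s i
        using that t gens[OF K] hom_in_carrier[OF hom] by (intro G.m_closed) auto
      have dX: "d (s, i) \<in> ?X \<and> ?e (d (s, i)) = t i \<otimes>\<^bsub>G\<^esub> case_sum \<theta> t s"
        if "s \<in> gens K <+> {..<p}" "i < p" for s i
      proof -
        have "d (s, i) = inv_into ?X ?e (t i \<otimes>\<^bsub>G\<^esub> case_sum \<theta> t s)" using that by (simp add: d_def)
        moreover have "t i \<otimes>\<^bsub>G\<^esub> case_sum \<theta> t s \<in> ?e ` ?X"
          using prod[OF that] bij_betw_imp_surj_on[OF bije] by simp
        ultimately show ?thesis using inv_into_into f_inv_into_f by metis
      qed
      have "d \<in> ?D K" using dX by (intro PiE_I) (auto simp: d_def simp del: SigmaI)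
      moreover have "transversal_table K (gens K) p d G \<theta> t"
        unfolding transversal_table_def
        using hom t bije dX by (simp add: case_prod_unfold)
      ultimately show "\<exists>d\<in>?D K. ?P K d G" by blast
    qed
  next
    fix K d G G' assume K: "K \<in> groups_of_order (p ^ n)" and d: "d \<in> ?D K"
      and G: "G \<in> groups_of_order (p ^ Suc n)" "G' \<in> groups_of_order (p ^ Suc n)"
      and "?P K d G" "?P K d G'"
    then obtain \<theta> t \<theta>' t' where tab: "transversal_table K (gens K) p d G \<theta> t"
      "transversal_table K (gens K) p d G' \<theta>' t'" by blast
    have "d \<in> (gens K <+> {..<p}) \<times> {..<p} \<rightarrow> carrier K \<times> {..<p}" using d by (simp add: PiE_def)
    then show "G \<cong> G'"
      using transversal_table_unique[OF groups_of_orderD(1)[OF K] _ _ p0 _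
        groups_of_orderD(1)[OF G(1)] groups_of_orderD(1)[OF G(2)] tab] gens[OF K] by simp
  qed (use fin groups_of_orderD in auto)
qed

lemma finite_iso_classes:
  assumes p: "Factorial_Ring.prime (p::nat)"
  shows "finite (groups_of_order (p ^ n) // iso_rel (groups_of_order (p ^ n)))"
proof (induction n)
  case 0
  have "G \<cong> H" if GH: "G \<in> groups_of_order 1" "H \<in> groups_of_order 1" for G H
  proof -
    note G = groups_of_orderD[OF GH(1)] and H = groups_of_orderD[OF GH(2)]
    have c: "carrier G = {\<one>\<^bsub>G\<^esub>}" "carrier H = {\<one>\<^bsub>H\<^esub>}"
      using G H card_1_singletonE group.is_monoid monoid.one_closed by (metis singletonD)+
    show ?thesis
      by (rule is_isoI[of "\<lambda>_. \<one>\<^bsub>H\<^esub>"])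
        (use H(1) in \<open>auto simp: iso_def hom_def c bij_betw_def group.is_monoid\<close>)
  qed
  then have "iso_rel (groups_of_order 1) = groups_of_order 1 \<times> groups_of_order 1" by auto
  then have "groups_of_order 1 // iso_rel (groups_of_order 1) \<subseteq> {groups_of_order 1}"
    by (auto simp: quotient_def)
  then show ?case using finite_subset by fastforce
next
  case (Suc n)
  then show ?case using num_all_Suc_le[OF p] by blast
qed


section \<open>Groups of class two from bilinear maps\<close>

definition bil :: "nat \<Rightarrow> (nat \<Rightarrow> nat \<Rightarrow> nat \<Rightarrow> int) \<Rightarrow> nat \<Rightarrow> (nat \<Rightarrow> int) \<Rightarrow> (nat \<Rightarrow> int) \<Rightarrow> int"
  where "bil r c k x y = (if k < r then 0 else \<Sum>i<r. \<Sum>j<r. c i j k * x i * y j)"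

text \<open>
  The central extension of \<open>(\<int>/N)\<^sup>r\<close> (coordinates below \<open>r\<close>) by \<open>(\<int>/N)\<^sup>s\<close> (coordinates
  from \<open>r\<close> on) whose cocycle is the bilinear map with coefficients \<open>c\<close>.
\<close>
definition class2_group :: "nat \<Rightarrow> nat \<Rightarrow> nat \<Rightarrow> (nat \<Rightarrow> nat \<Rightarrow> nat \<Rightarrow> int) \<Rightarrow> (nat \<Rightarrow> int) monoid"
  where "class2_group N r s c =
    \<lparr>carrier = {..<r + s} \<rightarrow>\<^sub>E {0..<int N},
     monoid.mult = (\<lambda>x y. \<lambda>k\<in>{..<r + s}. (x k + y k + bil r c k x y) mod int N),
     one = (\<lambda>k\<in>{..<r + s}. 0)\<rparr>"

lemma bil_cong:
  assumes "\<And>i. i < r \<Longrightarrow> [x i = x' i] (mod m)" "\<And>i. i < r \<Longrightarrow> [y i = y' i] (mod m)"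
  shows "[bil r c k x y = bil r c k x' y'] (mod m)"
  using assms by (auto simp: bil_def intro!: cong_sum cong_mult)

lemma bil_add_left: "bil r c k (\<lambda>i. x i + x' i) y = bil r c k x y + bil r c k x' y"
  by (simp add: bil_def algebra_simps sum.distrib)

lemma bil_add_right: "bil r c k x (\<lambda>i. y i + y' i) = bil r c k x y + bil r c k x y'"
  by (simp add: bil_def algebra_simps sum.distrib)

lemma bil_uminus_left: "bil r c k (\<lambda>i. - x i) y = - bil r c k x y"
  by (simp add: bil_def sum_negf)

lemma bil_zero_left: "(\<And>i. i < r \<Longrightarrow> x i = 0) \<Longrightarrow> bil r c k x y = 0"
  by (simp add: bil_def)

lemma bil_zero_right: "(\<And>i. i < r \<Longrightarrow> y i = 0) \<Longrightarrow> bil r c k x y = 0"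
  by (simp add: bil_def)

lemma bil_unit_vectors:
  assumes "i < r" "j < r" "r \<le> k"
    and x: "\<And>l. l < r \<Longrightarrow> x l = (if l = i then 1 else 0)"
    and y: "\<And>l. l < r \<Longrightarrow> y l = (if l = j then 1 else 0)"
  shows "bil r c k x y = c i j k"
proof -
  have "bil r c k x y =
      (\<Sum>a<r. \<Sum>b<r. c a b k * (if a = i then 1 else 0) * (if b = j then 1 else 0))"
    using \<open>r \<le> k\<close> x y by (simp add: bil_def)
  also have "\<dots> = (\<Sum>a<r. \<Sum>b<r. if b = j then (if a = i then c a b k else 0) else 0)"
    by (intro sum.cong refl) simp
  also have "\<dots> = c i j k" using assms(1,2) by simp
  finally show ?thesis .
qed

lemma class2_mult:
  "k < r + s \<Longrightarrow> (x \<otimes>\<^bsub>class2_group N r s c\<^esub> y) k = (x k + y k + bil r c k x y) mod int N"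
  by (simp add: class2_group_def)

lemma class2_mult_cong:
  "k < r + s \<Longrightarrow> [(x \<otimes>\<^bsub>class2_group N r s c\<^esub> y) k = x k + y k + bil r c k x y] (mod int N)"
  by (simp add: class2_mult)

lemma class2_mult_cong_base:
  "k < r \<Longrightarrow> [(x \<otimes>\<^bsub>class2_group N r s c\<^esub> y) k = x k + y k] (mod int N)"
  by (simp add: class2_mult bil_def)

lemma class2_eqI:
  assumes "x \<in> carrier (class2_group N r s c)" "y \<in> carrier (class2_group N r s c)"
    and "\<And>k. k < r + s \<Longrightarrow> [x k = y k] (mod int N)"
  shows "x = y"
proof
  fix k show "x k = y k"
  proof (cases "k < r + s")
    case True
    then have "0 \<le> x k" "x k < int N" "0 \<le> y k" "y k < int N"
      using assms(1,2) by (auto simp: class2_group_def PiE_iff)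
    then show ?thesis using assms(3)[OF True] by (simp add: cong_def)
  next
    case False
    then show ?thesis using assms(1,2) by (simp add: class2_group_def PiE_def extensional_def)
  qed
qed

lemma class2_closed:
  "0 < N \<Longrightarrow> x \<otimes>\<^bsub>class2_group N r s c\<^esub> y \<in> carrier (class2_group N r s c)"
  by (auto simp: class2_group_def)

lemma group_class2:
  assumes N: "0 < N"
  shows "Group.group (class2_group N r s c)"
proof (rule groupI)
  let ?G = "class2_group N r s c"
  show one: "\<one>\<^bsub>?G\<^esub> \<in> carrier ?G" using N by (auto simp: class2_group_def)
  show "x \<otimes>\<^bsub>?G\<^esub> y \<in> carrier ?G" for x y by (rule class2_closed[OF N])
  show "\<one>\<^bsub>?G\<^esub> \<otimes>\<^bsub>?G\<^esub> x = x" if "x \<in> carrier ?G" for x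
  proof (rule class2_eqI[OF class2_closed[OF N] that])
    fix k assume k: "k < r + s"
    then show "[(\<one>\<^bsub>?G\<^esub> \<otimes>\<^bsub>?G\<^esub> x) k = x k] (mod int N)"
      by (simp add: class2_mult bil_zero_left class2_group_def)
  qed
  show "(x \<otimes>\<^bsub>?G\<^esub> y) \<otimes>\<^bsub>?G\<^esub> z = x \<otimes>\<^bsub>?G\<^esub> (y \<otimes>\<^bsub>?G\<^esub> z)" for x y z
  proof (rule class2_eqI[OF class2_closed[OF N] class2_closed[OF N]])
    fix k assume k: "k < r + s"
    have "[((x \<otimes>\<^bsub>?G\<^esub> y) \<otimes>\<^bsub>?G\<^esub> z) k =
        (x k + y k + bil r c k x y) + z k + bil r c k (\<lambda>i. x i + y i) z] (mod int N)"
      by (rule cong_trans[OF class2_mult_cong[OF k]])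
        (intro cong_add bil_cong class2_mult_cong[OF k] class2_mult_cong_base cong_refl)
    moreover have "[(x \<otimes>\<^bsub>?G\<^esub> (y \<otimes>\<^bsub>?G\<^esub> z)) k =
        x k + (y k + z k + bil r c k y z) + bil r c k x (\<lambda>i. y i + z i)] (mod int N)"
      by (rule cong_trans[OF class2_mult_cong[OF k]])
        (intro cong_add bil_cong class2_mult_cong[OF k] class2_mult_cong_base cong_refl)
    ultimately show "[((x \<otimes>\<^bsub>?G\<^esub> y) \<otimes>\<^bsub>?G\<^esub> z) k = (x \<otimes>\<^bsub>?G\<^esub> (y \<otimes>\<^bsub>?G\<^esub> z)) k] (mod int N)"
      by (simp add: bil_add_left bil_add_right cong_def algebra_simps)
  qed
  show "\<exists>y\<in>carrier ?G. y \<otimes>\<^bsub>?G\<^esub> x = \<one>\<^bsub>?G\<^esub>" if "x \<in> carrier ?G" for x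
  proof
    define y where "y = (\<lambda>k\<in>{..<r + s}. (- x k + bil r c k x x) mod int N)"
    show "y \<in> carrier ?G" using N by (auto simp: y_def class2_group_def)
    show "y \<otimes>\<^bsub>?G\<^esub> x = \<one>\<^bsub>?G\<^esub>"
    proof (rule class2_eqI[OF class2_closed[OF N] one])
      fix k assume k: "k < r + s"
      have yk: "[y l = - x l + bil r c l x x] (mod int N)" if "l < r + s" for l
        using that by (simp add: y_def)
      have "[y l = - x l] (mod int N)" if "l < r" for l
        using yk[of l] that by (simp add: bil_def)
      then have "[bil r c k y x = bil r c k (\<lambda>i. - x i) x] (mod int N)"
        by (intro bil_cong) auto
      then have "[y k + x k + bil r c k y x = - x k + bil r c k x x + x k + - bil r c k x x] (mod int N)"
        using yk[OF k] by (intro cong_add) (auto simp: bil_uminus_left)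
      then show "[(y \<otimes>\<^bsub>?G\<^esub> x) k = \<one>\<^bsub>?G\<^esub> k] (mod int N)"
        using cong_trans[OF class2_mult_cong[OF k]] k by (simp add: class2_group_def)
    qed
  qed
qed

lemma order_class2: "order (class2_group N r s c) = N ^ (r + s)"
  by (simp add: class2_group_def order_def card_PiE)

lemma finite_class2: "finite (carrier (class2_group N r s c))"
  by (simp add: class2_group_def finite_PiE)

lemma class2_commute_cong:
  assumes "x \<otimes>\<^bsub>class2_group N r s c\<^esub> y = y \<otimes>\<^bsub>class2_group N r s c\<^esub> x" "k < r + s"
  shows "[bil r c k x y = bil r c k y x] (mod int N)"
proof -
  have "(x k + y k + bil r c k x y) mod int N = (y k + x k + bil r c k y x) mod int N"
    using fun_cong[OF assms(1), of k] assms(2) by (simp add: class2_mult)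
  then have "[(x k + y k) + bil r c k x y = (x k + y k) + bil r c k y x] (mod int N)"
    by (simp add: cong_def add.commute)
  then show ?thesis by (simp only: cong_add_lcancel)
qed

definition unit_vec :: "nat \<Rightarrow> nat \<Rightarrow> nat \<Rightarrow> int"
  where "unit_vec n i = (\<lambda>k\<in>{..<n}. if k = i then 1 else 0)"

lemma unit_vec_in_carrier: "1 < N \<Longrightarrow> unit_vec (r + s) i \<in> carrier (class2_group N r s c)"
  by (simp add: unit_vec_def class2_group_def)

lemma bil_unit_vec:
  "i < r \<Longrightarrow> j < r \<Longrightarrow> r \<le> k \<Longrightarrow> bil r c k (unit_vec (r + s) i) (unit_vec (r + s) j) = c i j k"
  by (intro bil_unit_vectors) (simp_all add: unit_vec_def)

lemma class2_unit_vec_swap: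
  assumes N: "1 < N" and ij: "i < r" "j < r"
    and c: "\<And>k. r \<le> k \<Longrightarrow> k < r + s \<Longrightarrow> c j i k = 0"
    and u: "u \<in> carrier (class2_group N r s c)" "\<And>k. k < r \<Longrightarrow> u k = 0"
      "\<And>k. r \<le> k \<Longrightarrow> k < r + s \<Longrightarrow> [u k = c i j k] (mod int N)"
  shows "unit_vec (r + s) i \<otimes>\<^bsub>class2_group N r s c\<^esub> unit_vec (r + s) j =
    u \<otimes>\<^bsub>class2_group N r s c\<^esub> (unit_vec (r + s) j \<otimes>\<^bsub>class2_group N r s c\<^esub> unit_vec (r + s) i)"
    (is "?a \<otimes>\<^bsub>?G\<^esub> ?b = _")
proof (rule class2_eqI[OF class2_closed class2_closed])
  fix k assume k: "k < r + s"
  have "[(u \<otimes>\<^bsub>?G\<^esub> (?b \<otimes>\<^bsub>?G\<^esub> ?a)) k = u k + (?b k + ?a k + bil r c k ?b ?a) + 0] (mod int N)"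
    by (rule cong_trans[OF class2_mult_cong[OF k]])
      (simp add: bil_zero_left u(2), intro cong_add cong_refl class2_mult_cong[OF k])
  moreover have "[u k + (?b k + ?a k + bil r c k ?b ?a) + 0 = ?a k + ?b k + bil r c k ?a ?b] (mod int N)"
  proof (cases "k < r")
    case True
    then show ?thesis using u(2) by (simp add: bil_def add.commute)
  next
    case False
    then have "[u k + (?a k + ?b k) = c i j k + (?a k + ?b k)] (mod int N)"
      using u(3) k by (intro cong_add) auto
    then show ?thesis using False ij c k by (simp add: bil_unit_vec algebra_simps)
  qed
  ultimately show "[(?a \<otimes>\<^bsub>?G\<^esub> ?b) k = (u \<otimes>\<^bsub>?G\<^esub> (?b \<otimes>\<^bsub>?G\<^esub> ?a)) k] (mod int N)"
    using class2_mult_cong[OF k, where x = ?a and y = ?b and N = N and c = c] by (meson cong_sym cong_trans)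
qed (use N in auto)


section \<open>Many groups of prime power order\<close>

lemma subgroup_class2_centre:
  assumes N: "0 < N"
  shows "subgroup {z \<in> carrier (class2_group N r s c). \<forall>k<r. z k = 0} (class2_group N r s c)"
    (is "subgroup ?Z ?G")
proof -
  interpret Group.group ?G by (rule group_class2[OF N])
  have mult0: "(x \<otimes>\<^bsub>?G\<^esub> y) k = 0" if "k < r" "x k = 0" "y k = 0" for x y k
    using that by (simp add: class2_mult bil_def)
  show ?thesis
  proof (rule subgroupI)
    have "\<one>\<^bsub>?G\<^esub> \<in> ?Z" by (simp add: one_closed) (simp add: class2_group_def)
    then show "?Z \<noteq> {}" by blast
    fix x assume x: "x \<in> ?Z"
    have "(inv\<^bsub>?G\<^esub> x) k = 0" if k: "k < r" for k
    proof -
      have "(inv\<^bsub>?G\<^esub> x) k \<in> {0..<int N}"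
        using inv_closed[of x] x k by (auto simp: class2_group_def PiE_iff)
      moreover have "((inv\<^bsub>?G\<^esub> x) k + x k) mod int N = 0"
        using l_inv[of x] x k class2_mult[of k r s N c "inv\<^bsub>?G\<^esub> x" x]
        by (simp add: bil_def) (simp add: class2_group_def)
      ultimately show ?thesis using x k by simp
    qed
    then show "inv\<^bsub>?G\<^esub> x \<in> ?Z" using x by simp
  qed (use mult0 in auto)
qed

text \<open>
  An isomorphism from a class two group is determined by its values on the unit vectors and on
  generators of the central coordinates, and those coordinates form the same group for all
  coefficients; the commutators of the unit vectors then reveal the coefficients.  So each
  isomorphism class is hit by at most \<open>(p ^ n) ^ (p * n)\<close> of the \<open>p ^ (a * a * s)\<close> coefficient
  systems, where \<open>n = 2 * a + s\<close>.
\<close>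
lemma num_all_lower_bound:
  assumes p: "Factorial_Ring.prime (p::nat)"
  shows "p ^ (a * a * s) \<le> num_all p (2 * a + s) * (p ^ (2 * a + s)) ^ (p * (2 * a + s))"
proof -
  have p1: "1 < p" and p0: "0 < p" using p prime_gt_1_nat prime_gt_0_nat by auto
  define r where "r = 2 * a"
  define n where "n = r + s"
  let ?\<H> = "groups_of_order (p ^ n)"
  define J where "J = {..<a} \<times> {a..<r} \<times> {r..<r + s}"
  define coeff where "coeff f i j k = (if (i, j, k) \<in> J then f (i, j, k) else 0)"
    for f :: "nat \<times> nat \<times> nat \<Rightarrow> int" and i j k
  define C where "C = J \<rightarrow>\<^sub>E {0..<int p}"
  define Gr where "Gr f = class2_group p r s (coeff f)" for f
  define Z where "Z = {z \<in> {..<r + s} \<rightarrow>\<^sub>E {0..<int p}. \<forall>k<r. z k = 0}"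
  have Z: "subgroup Z (Gr f)" for f
    using subgroup_class2_centre[OF p0, of r s "coeff f"] by (simp add: Z_def Gr_def class2_group_def)
  have gr: "Group.group (Gr f)" for f unfolding Gr_def by (rule group_class2[OF p0])
  have carr: "carrier (Gr f) = {..<r + s} \<rightarrow>\<^sub>E {0..<int p}" for f
    by (simp add: Gr_def class2_group_def)
  define ZG where "ZG = Gr (\<lambda>_. 0)\<lparr>carrier := Z\<rparr>"
  have grZ: "Group.group ZG" unfolding ZG_def by (rule group.subgroup_imp_group[OF gr Z])
  have multZ: "x \<otimes>\<^bsub>Gr f\<^esub> y = x \<otimes>\<^bsub>ZG\<^esub> y" if "x \<in> Z" for x y f
    using that by (auto simp: ZG_def Gr_def class2_group_def Z_def bil_zero_left fun_eq_iff)
  have ZC: "carrier ZG = Z" and Zsub: "Z \<subseteq> carrier (Gr f)" for f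
    by (auto simp: ZG_def carr Z_def)
  have finZ: "finite Z" using finite_class2[of p r s] by (auto simp: Z_def class2_group_def)
  have cardZ: "card Z \<le> p ^ s"
  proof -
    have "inj_on (\<lambda>z. restrict z {r..<r + s}) Z"
    proof (rule inj_onI)
      fix x y assume xy: "x \<in> Z" "y \<in> Z" and eq: "restrict x {r..<r + s} = restrict y {r..<r + s}"
      show "x = y"
      proof
        fix k
        consider "k < r" | "r \<le> k" "k < r + s" | "r + s \<le> k" by linarith
        then show "x k = y k"
        proof cases
          case 1
          then show ?thesis using xy by (simp add: Z_def)
        next
          case 2
          then show ?thesis using fun_cong[OF eq, of k] by simp
        next
          case 3
          then show ?thesis using xy unfolding Z_def by (simp add: PiE_def extensional_def)
        qed
      qed
    qed
    moreover have "(\<lambda>z. restrict z {r..<r + s}) ` Z \<subseteq> {r..<r + s} \<rightarrow>\<^sub>E {0..<int p}"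
      by (auto simp: Z_def PiE_iff)
    ultimately have "card Z \<le> card ({r..<r + s} \<rightarrow>\<^sub>E {0..<int p})"
      by (intro card_inj_on_le finite_PiE) auto
    then show ?thesis by (simp add: card_PiE)
  qed
  obtain T where T: "T \<subseteq> Z" "generate ZG T = Z" "2 ^ card T \<le> card Z"
    using ex_small_generating_set[OF grZ] finZ ZC by (auto simp: order_def)
  have finT: "finite T" using T(1) finZ finite_subset by blast
  let ?e = "unit_vec (r + s)"
  define U where "U = T \<union> ?e ` {..<r}"
  have eG: "?e i \<in> carrier (Gr f)" for i f unfolding Gr_def by (rule unit_vec_in_carrier[OF p1])
  have cardU: "card U \<le> p * n"
  proof -
    have "(2::nat) ^ card T \<le> p ^ s" using T(3) cardZ by simp
    also have "\<dots> \<le> (2 ^ p) ^ s" by (rule power_mono) auto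
    finally have "card T \<le> p * s" by (simp flip: power_mult)
    moreover have "card (?e ` {..<r}) \<le> p * r"
      using card_image_le[of "{..<r}" ?e] p0 by (simp add: le_trans[of _ r "p * r"])
    moreover have "card U \<le> card T + card (?e ` {..<r})" unfolding U_def by (rule card_Un_le)
    ultimately show ?thesis by (simp add: n_def distrib_left)
  qed
  have "finite C \<and> card C \<le> num_iso_classes ?\<H> * (p ^ n) ^ (p * n)"
  proof (rule card_le_num_iso_classes[where D = "\<lambda>K. U \<rightarrow>\<^sub>E carrier K"
        and P = "\<lambda>K d f. \<exists>\<theta>\<in>iso (Gr f) K. d = restrict \<theta> U"])
    fix K assume "K \<in> ?\<H>"
    note K = groups_of_orderD[OF this]
    have finU: "finite U" using finT by (simp add: U_def)
    have "(p ^ n) ^ card U \<le> (p ^ n) ^ (p * n)" using cardU p0 by (intro power_increasing) auto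
    then show "finite (U \<rightarrow>\<^sub>E carrier K) \<and> card (U \<rightarrow>\<^sub>E carrier K) \<le> (p ^ n) ^ (p * n)"
      using finU K by (simp add: card_PiE finite_PiE)
  next
    fix f assume "f \<in> C"
    have "finite (carrier (Gr f))" "order (Gr f) = p ^ n"
      by (simp_all add: Gr_def finite_class2 order_class2 n_def)
    then obtain K where K: "K \<in> ?\<H>" and iso: "Gr f \<cong> K"
      using finite_group_iso_nat[OF gr, of f] by auto
    show "\<exists>K\<in>?\<H>. \<forall>K'\<in>?\<H>. K \<cong> K' \<longrightarrow> (\<exists>d\<in>U \<rightarrow>\<^sub>E carrier K'. \<exists>\<theta>\<in>iso (Gr f) K'. d = restrict \<theta> U)"
    proof (intro bexI[OF _ K] ballI impI)
      fix K' assume "K' \<in> ?\<H>" "K \<cong> K'"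
      then have "Gr f \<cong> K'" using iso iso_trans by blast
      then obtain \<theta> where \<theta>: "\<theta> \<in> iso (Gr f) K'" by (auto simp: is_iso_def)
      have "U \<subseteq> carrier (Gr f)" using T(1) Zsub eG by (auto simp: U_def)
      then have "restrict \<theta> U \<in> U \<rightarrow>\<^sub>E carrier K'"
        using \<theta> by (auto simp: iso_def hom_def)
      then show "\<exists>d\<in>U \<rightarrow>\<^sub>E carrier K'. \<exists>\<theta>\<in>iso (Gr f) K'. d = restrict \<theta> U" using \<theta> by blast
    qed
  next
    fix K d f f' assume K: "K \<in> ?\<H>" and f: "f \<in> C" "f' \<in> C"
      and "\<exists>\<theta>\<in>iso (Gr f) K. d = restrict \<theta> U" "\<exists>\<theta>\<in>iso (Gr f') K. d = restrict \<theta> U"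
    then obtain \<theta> \<theta>' where th: "\<theta> \<in> iso (Gr f) K" "\<theta>' \<in> iso (Gr f') K"
      and "restrict \<theta> U = restrict \<theta>' U" by auto
    then have eqU: "\<theta> u = \<theta>' u" if "u \<in> U" for u using that by (metis restrict_apply')
    interpret K: Group.group K by (rule groups_of_orderD(1)[OF K])
    have hom: "\<theta> \<in> hom (Gr f) K" "\<theta>' \<in> hom (Gr f') K" using th by (auto simp: iso_def)
    have "\<eta> \<in> hom ZG K" if \<eta>: "\<eta> \<in> hom (Gr g) K" for \<eta> g
    proof (rule homI)
      fix x y assume xy: "x \<in> carrier ZG" "y \<in> carrier ZG"
      then have "x \<in> Z" "x \<in> carrier (Gr g)" "y \<in> carrier (Gr g)" using ZC Zsub by blast+
      then show "\<eta> x \<in> carrier K" "\<eta> (x \<otimes>\<^bsub>ZG\<^esub> y) = \<eta> x \<otimes>\<^bsub>K\<^esub> \<eta> y"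
        using hom_mult[OF \<eta>] hom_in_carrier[OF \<eta>] by (simp_all add: multZ[where f = g, symmetric])
    qed
    then have homZ: "\<theta> \<in> hom ZG K" "\<theta>' \<in> hom ZG K" using hom by blast+
    have eqZ: "\<theta> z = \<theta>' z" if "z \<in> Z" for z
      by (rule hom_eq_on_generate[OF grZ K.is_group homZ, of T]) (use T that ZC eqU U_def in auto)
    have val: "g x \<in> {0..<int p}" if "g \<in> C" "x \<in> J" for g x using that by (auto simp: C_def)
    have coeffs: "f (i, j, k) = f' (i, j, k)" if ijk: "(i, j, k) \<in> J" for i j k
    proof -
      have ij: "i < r" "j < r" using ijk by (auto simp: J_def r_def)
      define u where "u g = (\<lambda>l\<in>{..<r + s}. coeff g i j l)" for g
      have u0: "u g l = 0" if "l < r" for g l using that by (simp add: u_def coeff_def J_def)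
      have uc: "u g \<in> {..<r + s} \<rightarrow>\<^sub>E {0..<int p}" if "g \<in> C" for g
        using val[OF that] p0 by (auto simp: u_def coeff_def)
      then have uZ: "u g \<in> Z" if "g \<in> C" for g using that u0 by (auto simp: Z_def)
      have swap: "?e i \<otimes>\<^bsub>Gr g\<^esub> ?e j = u g \<otimes>\<^bsub>Gr g\<^esub> (?e j \<otimes>\<^bsub>Gr g\<^esub> ?e i)" if "g \<in> C" for g
        unfolding Gr_def
      proof (rule class2_unit_vec_swap[OF p1 ij])
        show "coeff g j i l = 0" for l using ijk by (auto simp: coeff_def J_def)
        show "u g \<in> carrier (class2_group p r s (coeff g))"
          using uc[OF that] by (simp add: class2_group_def)
      qed (use u0 in \<open>auto simp: u_def\<close>)
      have image: "\<eta> (u g) = (\<eta> (?e i) \<otimes>\<^bsub>K\<^esub> \<eta> (?e j)) \<otimes>\<^bsub>K\<^esub> inv\<^bsub>K\<^esub> (\<eta> (?e j) \<otimes>\<^bsub>K\<^esub> \<eta> (?e i))"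
        if g: "g \<in> C" and \<eta>: "\<eta> \<in> hom (Gr g) K" for g \<eta>
      proof -
        interpret g: group_hom "Gr g" K \<eta>
          using gr K.is_group \<eta> by (simp add: group_hom_def group_hom_axioms_def)
        have ug: "u g \<in> carrier (Gr g)" using uc[OF g] by (simp add: carr)
        have "\<eta> (?e i) \<otimes>\<^bsub>K\<^esub> \<eta> (?e j) = \<eta> (u g) \<otimes>\<^bsub>K\<^esub> (\<eta> (?e j) \<otimes>\<^bsub>K\<^esub> \<eta> (?e i))"
          using arg_cong[OF swap[OF g], of \<eta>] eG ug by simp
        moreover have "x = x \<otimes>\<^bsub>K\<^esub> y \<otimes>\<^bsub>K\<^esub> inv\<^bsub>K\<^esub> y" if "x \<in> carrier K" "y \<in> carrier K" for x y
          using that by (simp add: K.m_assoc)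
        ultimately show ?thesis using eG ug by simp
      qed
      have "?e i \<in> U" "?e j \<in> U" using ij by (auto simp: U_def)
      then have "\<theta> (u f) = \<theta>' (u f')"
        using image[OF f(1) hom(1)] image[OF f(2) hom(2)] eqU by simp
      also have "\<dots> = \<theta> (u f')" using eqZ[OF uZ[OF f(2)]] by simp
      finally have "\<theta> (u f) = \<theta> (u f')" .
      moreover have "inj_on \<theta> ({..<r + s} \<rightarrow>\<^sub>E {0..<int p})"
        using th(1) by (simp add: iso_def bij_betw_def carr)
      ultimately have "u f = u f'" using uc f by (blast dest: inj_onD)
      then have "u f k = u f' k" by simp
      then show ?thesis using ijk by (auto simp: u_def coeff_def J_def)
    qed
    show "f = f'"
    proof (rule PiE_ext[of f J "\<lambda>_. {0..<int p}"])
      show "f x = f' x" if "x \<in> J" for x using coeffs that by (cases x) auto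
    qed (use f in \<open>auto simp: C_def\<close>)
  qed (use groups_of_orderD finite_iso_classes[OF p] in auto)
  moreover have "card C = p ^ (a * a * s)"
    by (simp add: C_def J_def r_def card_PiE card_cartesian_product mult.assoc)
  ultimately show ?thesis by (simp add: num_all_def n_def r_def)
qed


section \<open>Second cohomology with rational cochains\<close>

definition qz :: "rat \<Rightarrow> rat set"
  where "qz x = \<int> #>\<^bsub>rat_group\<^esub> x"

lemma normal_Ints: "\<int> \<lhd> rat_group"
proof -
  interpret comm_group rat_group by (fact comm_group_rat_group)
  have "subgroup \<int> rat_group"
  proof (rule subgroupI)
    show "\<int> \<subseteq> carrier rat_group" "\<int> \<noteq> ({} :: rat set)" by (auto simp: rat_group_def)
    show "inv\<^bsub>rat_group\<^esub> a \<in> \<int>" if "a \<in> \<int>" for a using that by simp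
    show "a \<otimes>\<^bsub>rat_group\<^esub> b \<in> \<int>" if "a \<in> \<int>" "b \<in> \<int>" for a b
      using that by (simp add: rat_group_def)
  qed
  then show ?thesis by (rule subgroup_imp_normal)
qed

lemma qz_hom: "qz \<in> hom rat_group QmodZ"
  using normal.r_coset_hom_Mod[OF normal_Ints] by (simp add: QmodZ_def qz_def[abs_def])

lemma group_QmodZ: "Group.group QmodZ" and group_rat_group: "Group.group rat_group"
  using comm_group_QmodZ comm_group_rat_group by (simp_all add: comm_group_def)

lemma qz_closed [simp]: "qz x \<in> carrier QmodZ"
  using hom_in_carrier[OF qz_hom] by (simp add: rat_group_def)

lemma qz_surj: "a \<in> carrier QmodZ \<Longrightarrow> \<exists>x. a = qz x"
  by (auto simp: QmodZ_def qz_def carrier_FactGroup)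

lemma qz_add: "qz x \<otimes>\<^bsub>QmodZ\<^esub> qz y = qz (x + y)"
  using hom_mult[OF qz_hom, of x y] by (simp add: rat_group_def)

lemma qz_zero: "\<one>\<^bsub>QmodZ\<^esub> = qz 0"
  using hom_one[OF qz_hom group_rat_group group_QmodZ] by (simp add: rat_group_def)

lemma qz_uminus: "inv\<^bsub>QmodZ\<^esub> qz x = qz (- x)"
  by (rule group.inv_equality[OF group_QmodZ]) (simp_all add: qz_add qz_zero)

lemma qz_eq_iff: "qz x = qz y \<longleftrightarrow> x - y \<in> \<int>"
proof
  interpret comm_group rat_group by (fact comm_group_rat_group)
  have sub: "subgroup \<int> rat_group" using normal_Ints by (simp add: normal_imp_subgroup)
  show "qz x = qz y \<Longrightarrow> x - y \<in> \<int>"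
    using repr_independenceD[OF sub, of x y] repr_independenceD[OF sub, of y x]
    by (auto simp: qz_def r_coset_def rat_group_def)
  assume "x - y \<in> \<int>"
  moreover have "x = (x - y) + y" by simp
  ultimately have "x \<in> \<int> #>\<^bsub>rat_group\<^esub> y" unfolding r_coset_def rat_group_def by force
  then show "qz x = qz y" using repr_independence[OF _ _ sub] by (auto simp: qz_def rat_group_def)
qed

text \<open>
  Cochains with values in \<open>\<rat>/\<int>\<close> are handled through rational representatives, so that the
  cocycle and coboundary conditions become integrality statements.
\<close>
definition rat_cochain :: "('a, 'c) monoid_scheme \<Rightarrow> ('a \<Rightarrow> 'a \<Rightarrow> rat) \<Rightarrow> 'a \<times> 'a \<Rightarrow> rat set"
  where "rat_cochain G F = (\<lambda>(g, h)\<in>carrier G \<times> carrier G. qz (F g h))"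

definition rat_coboundary :: "('a, 'c) monoid_scheme \<Rightarrow> ('a \<Rightarrow> rat) \<Rightarrow> 'a \<Rightarrow> 'a \<Rightarrow> rat"
  where "rat_coboundary G \<phi> g h = \<phi> h - \<phi> (g \<otimes>\<^bsub>G\<^esub> h) + \<phi> g"

definition rat_cocycle :: "('a, 'c) monoid_scheme \<Rightarrow> ('a \<Rightarrow> 'a \<Rightarrow> rat) \<Rightarrow> bool"
  where "rat_cocycle G F \<longleftrightarrow> (\<forall>g\<in>carrier G. \<forall>h\<in>carrier G. \<forall>k\<in>carrier G.
    F h k - F (g \<otimes>\<^bsub>G\<^esub> h) k + F g (h \<otimes>\<^bsub>G\<^esub> k) - F g h \<in> \<int>)"

definition H2_class :: "('a, 'c) monoid_scheme \<Rightarrow> ('a \<Rightarrow> 'a \<Rightarrow> rat) \<Rightarrow> ('a \<times> 'a \<Rightarrow> rat set) set"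
  where "H2_class G F = coboundaries2 G QmodZ #>\<^bsub>cocycles2 G QmodZ\<^esub> rat_cochain G F"

context
  fixes G :: "('a, 'c) monoid_scheme"
  assumes G: "Group.group G"
begin

interpretation G: Group.group G by (fact G)
interpretation Z: comm_group "cocycles2 G QmodZ" by (rule comm_group_cocycles2[OF G comm_group_QmodZ])

lemma rat_cochain_closed: "rat_cochain G F \<in> carrier (cochains2 G QmodZ)"
  by (auto simp: rat_cochain_def cochains2_def)

lemma rat_cochain_cocycle_iff:
  "rat_cochain G F \<in> carrier (cocycles2 G QmodZ) \<longleftrightarrow> rat_cocycle G F"
proof -
  have "coboundary2 G QmodZ (rat_cochain G F) =
    (\<lambda>(g, h, k)\<in>carrier G \<times> carrier G \<times> carrier G.
      qz (F h k - F (g \<otimes>\<^bsub>G\<^esub> h) k + F g (h \<otimes>\<^bsub>G\<^esub> k) - F g h))"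
    by (auto simp: coboundary2_def rat_cochain_def fun_eq_iff qz_uminus qz_add)
  then have "rat_cochain G F \<in> carrier (cocycles2 G QmodZ) \<longleftrightarrow>
    (\<forall>g\<in>carrier G. \<forall>h\<in>carrier G. \<forall>k\<in>carrier G.
      qz (F h k - F (g \<otimes>\<^bsub>G\<^esub> h) k + F g (h \<otimes>\<^bsub>G\<^esub> k) - F g h) = qz 0)"
    using rat_cochain_closed
    by (auto simp: cocycles2_def kernel_def cochains3_def qz_zero fun_eq_iff restrict_def)
  then show ?thesis by (simp add: rat_cocycle_def qz_eq_iff)
qed

lemma cocycle_lift:
  assumes "f \<in> carrier (cocycles2 G QmodZ)"
  shows "\<exists>F. f = rat_cochain G F"
proof -
  have f: "f \<in> carrier G \<times> carrier G \<rightarrow>\<^sub>E carrier QmodZ"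
    using assms by (simp add: cocycles2_def kernel_def cochains2_def)
  then have "\<forall>z\<in>carrier G \<times> carrier G. \<exists>x. f z = qz x" using qz_surj by blast
  from bchoice[OF this] obtain F where F: "\<forall>z\<in>carrier G \<times> carrier G. f z = qz (F z)" by (rule exE)
  have "f = rat_cochain G (\<lambda>g h. F (g, h))"
  proof
    fix z show "f z = rat_cochain G (\<lambda>g h. F (g, h)) z"
    proof (cases "z \<in> carrier G \<times> carrier G")
      case True
      then show ?thesis using F by (auto simp: rat_cochain_def)
    next
      case False
      then show ?thesis using PiE_arb[OF f False] by (simp add: rat_cochain_def restrict_def)
    qed
  qed
  then show ?thesis by blast
qed

lemma rat_cochain_coboundary_iff:
  "rat_cochain G F \<in> coboundaries2 G QmodZ \<longleftrightarrow>
    (\<exists>\<phi>. \<forall>g\<in>carrier G. \<forall>h\<in>carrier G. F g h - rat_coboundary G \<phi> g h \<in> \<int>)"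
proof -
  have cob: "coboundary1 G QmodZ (\<lambda>g\<in>carrier G. qz (\<phi> g)) = rat_cochain G (rat_coboundary G \<phi>)" for \<phi>
    by (auto simp: coboundary1_def rat_cochain_def rat_coboundary_def fun_eq_iff qz_uminus qz_add)
  have lift: "\<exists>\<phi>. c = (\<lambda>g\<in>carrier G. qz (\<phi> g))" if "c \<in> carrier (cochains1 G QmodZ)" for c
  proof -
    have c: "c \<in> carrier G \<rightarrow>\<^sub>E carrier QmodZ" using that by (simp add: cochains1_def)
    then have "\<forall>g\<in>carrier G. \<exists>x. c g = qz x" using qz_surj by blast
    from bchoice[OF this] obtain \<phi> where "\<forall>g\<in>carrier G. c g = qz (\<phi> g)" by (rule exE)
    then have "c = (\<lambda>g\<in>carrier G. qz (\<phi> g))"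
      using c by (auto simp: PiE_def extensional_def fun_eq_iff)
    then show ?thesis by blast
  qed
  have eq: "rat_cochain G F = rat_cochain G F' \<longleftrightarrow> (\<forall>g\<in>carrier G. \<forall>h\<in>carrier G. F g h - F' g h \<in> \<int>)"
    for F'
    by (auto simp: rat_cochain_def fun_eq_iff restrict_def simp flip: qz_eq_iff)
  have "rat_cochain G F \<in> coboundaries2 G QmodZ \<longleftrightarrow>
      (\<exists>\<phi>. rat_cochain G F = rat_cochain G (rat_coboundary G \<phi>))"
  proof
    assume "rat_cochain G F \<in> coboundaries2 G QmodZ"
    then obtain c where "c \<in> carrier (cochains1 G QmodZ)" "rat_cochain G F = coboundary1 G QmodZ c"
      unfolding coboundaries2_def by blast
    then show "\<exists>\<phi>. rat_cochain G F = rat_cochain G (rat_coboundary G \<phi>)" using lift cob by force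
  next
    assume "\<exists>\<phi>. rat_cochain G F = rat_cochain G (rat_coboundary G \<phi>)"
    then obtain \<phi> where "rat_cochain G F = coboundary1 G QmodZ (\<lambda>g\<in>carrier G. qz (\<phi> g))"
      using cob by force
    moreover have "(\<lambda>g\<in>carrier G. qz (\<phi> g)) \<in> carrier (cochains1 G QmodZ)"
      by (simp add: cochains1_def)
    ultimately show "rat_cochain G F \<in> coboundaries2 G QmodZ" unfolding coboundaries2_def by blast
  qed
  then show ?thesis by (simp add: eq)
qed

lemma H2_class_eq_iff:
  assumes F: "rat_cocycle G F" and F': "rat_cocycle G F'"
  shows "H2_class G F = H2_class G F' \<longleftrightarrow>
    (\<exists>\<phi>. \<forall>g\<in>carrier G. \<forall>h\<in>carrier G. F g h - F' g h - rat_coboundary G \<phi> g h \<in> \<int>)"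
proof -
  let ?B = "coboundaries2 G QmodZ" and ?D = "rat_cochain G (\<lambda>g h. F g h - F' g h)"
  have B: "subgroup ?B (cocycles2 G QmodZ)" by (rule subgroup_coboundaries2[OF G comm_group_QmodZ])
  have Fc: "rat_cochain G F \<in> carrier (cocycles2 G QmodZ)"
    and F'c: "rat_cochain G F' \<in> carrier (cocycles2 G QmodZ)"
    using F F' by (simp_all add: rat_cochain_cocycle_iff)
  have "rat_cocycle G (\<lambda>g h. F g h - F' g h)"
    unfolding rat_cocycle_def
  proof (intro ballI)
    fix g h k assume "g \<in> carrier G" "h \<in> carrier G" "k \<in> carrier G"
    then have "(F h k - F (g \<otimes>\<^bsub>G\<^esub> h) k + F g (h \<otimes>\<^bsub>G\<^esub> k) - F g h) -
        (F' h k - F' (g \<otimes>\<^bsub>G\<^esub> h) k + F' g (h \<otimes>\<^bsub>G\<^esub> k) - F' g h) \<in> \<int>"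
      using F F' by - (rule Ints_diff; simp add: rat_cocycle_def)
    then show "F h k - F' h k - (F (g \<otimes>\<^bsub>G\<^esub> h) k - F' (g \<otimes>\<^bsub>G\<^esub> h) k) +
        (F g (h \<otimes>\<^bsub>G\<^esub> k) - F' g (h \<otimes>\<^bsub>G\<^esub> k)) - (F g h - F' g h) \<in> \<int>"
      by (simp add: algebra_simps)
  qed
  then have Dc: "?D \<in> carrier (cocycles2 G QmodZ)" by (simp add: rat_cochain_cocycle_iff)
  have split: "rat_cochain G F = ?D \<otimes>\<^bsub>cocycles2 G QmodZ\<^esub> rat_cochain G F'"
    by (auto simp: cocycles2_def cochains2_def rat_cochain_def fun_eq_iff qz_add)
  have "H2_class G F = H2_class G F' \<longleftrightarrow> ?D \<in> ?B"
  proof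
    assume "H2_class G F = H2_class G F'"
    then have "rat_cochain G F \<in> ?B #>\<^bsub>cocycles2 G QmodZ\<^esub> rat_cochain G F'"
      unfolding H2_class_def using Z.rcos_self[OF Fc B] by simp
    then obtain b where b: "b \<in> ?B" and "rat_cochain G F = b \<otimes>\<^bsub>cocycles2 G QmodZ\<^esub> rat_cochain G F'"
      by (auto simp: r_coset_def)
    then have "?D = b" using split Dc F'c subgroup.mem_carrier[OF B b] by simp
    then show "?D \<in> ?B" using b by simp
  next
    assume "?D \<in> ?B"
    then have "rat_cochain G F \<in> ?B #>\<^bsub>cocycles2 G QmodZ\<^esub> rat_cochain G F'"
      using split by (auto simp: r_coset_def)
    then show "H2_class G F = H2_class G F'"
      unfolding H2_class_def using Z.repr_independence[OF _ F'c B] by simp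
  qed
  then show ?thesis by (simp add: rat_cochain_coboundary_iff)
qed

lemma H2_class_surj:
  assumes "U \<in> carrier (H2 G QmodZ)"
  shows "\<exists>F. rat_cocycle G F \<and> U = H2_class G F"
proof -
  obtain f where f: "f \<in> carrier (cocycles2 G QmodZ)"
    "U = coboundaries2 G QmodZ #>\<^bsub>cocycles2 G QmodZ\<^esub> f"
    using assms by (auto simp: H2_def carrier_FactGroup)
  then show ?thesis using cocycle_lift[OF f(1)] rat_cochain_cocycle_iff by (auto simp: H2_class_def)
qed

text \<open>
  The averaging argument: summing the cocycle identity over the last argument shows that
  \<open>card (carrier G) * F\<close> is a coboundary modulo \<open>\<int>\<close>.  Dividing the cochain that bounds it
  by the group order normalises the cocycle to values in \<open>(1/n)\<int>/\<int>\<close>, of which there are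
  finitely many.  Only this finiteness makes a lower bound on the cardinality of the
  Bogomolov multiplier follow from exhibiting elements.
\<close>
lemma finite_H2_QmodZ:
  assumes fin: "finite (carrier G)"
  shows "finite (carrier (H2 G QmodZ))"
proof -
  define n where "n = card (carrier G)"
  have n: "0 < n" using fin G.one_closed card_gt_0_iff unfolding n_def by blast
  define V where "V = (\<lambda>a. qz (of_nat a / of_nat n)) ` {..<n}"
  let ?C = "carrier G \<times> carrier G \<rightarrow>\<^sub>E V"
  have inV: "qz x \<in> V" if int: "of_nat n * x \<in> \<int>" for x
  proof -
    obtain b :: int where b: "of_nat n * x = of_int b" using Ints_cases[OF int] by blast
    let ?a = "nat (b mod int n)"
    have "x - of_nat ?a / of_nat n = of_int (b div int n)"
    proof -
      have "b = int n * (b div int n) + int ?a" using n by simp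
      then have "rat_of_int b = of_int (int n * (b div int n) + int ?a)" by (rule arg_cong)
      then have "rat_of_int b = of_nat n * of_int (b div int n) + of_nat ?a" by simp
      then have "of_nat n * x = of_nat n * of_int (b div int n) + of_nat ?a" using b by simp
      then show ?thesis using n by (simp add: field_simps)
    qed
    then have "qz x = qz (of_nat ?a / of_nat n)" by (simp add: qz_eq_iff)
    moreover have "?a < n" using n by (simp add: nat_less_iff)
    ultimately show ?thesis unfolding V_def by blast
  qed
  have "carrier (H2 G QmodZ) \<subseteq> (\<lambda>f. coboundaries2 G QmodZ #>\<^bsub>cocycles2 G QmodZ\<^esub> f) ` ?C"
  proof
    fix U assume "U \<in> carrier (H2 G QmodZ)"
    then obtain F where F: "rat_cocycle G F" and U: "U = H2_class G F" using H2_class_surj by blast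
    define S where "S g = (\<Sum>k\<in>carrier G. F g k)" for g
    define \<phi> where "\<phi> g = S g / of_nat n" for g
    define F' where "F' g h = F g h - rat_coboundary G \<phi> g h" for g h
    have int: "of_nat n * F' g h \<in> \<int>" if gh: "g \<in> carrier G" "h \<in> carrier G" for g h
    proof -
      have "(\<Sum>k\<in>carrier G. F h k - F (g \<otimes>\<^bsub>G\<^esub> h) k + F g (h \<otimes>\<^bsub>G\<^esub> k) - F g h) \<in> \<int>"
        using F gh by (intro Ints_sum) (auto simp: rat_cocycle_def)
      moreover have "(\<Sum>k\<in>carrier G. F g (h \<otimes>\<^bsub>G\<^esub> k)) = S g"
        unfolding S_def
        by (rule sum.reindex_bij_witness[where i = "\<lambda>k. inv\<^bsub>G\<^esub> h \<otimes>\<^bsub>G\<^esub> k" and j = "\<lambda>k. h \<otimes>\<^bsub>G\<^esub> k"])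
          (use gh in \<open>auto simp flip: G.m_assoc\<close>)
      ultimately have "S h - S (g \<otimes>\<^bsub>G\<^esub> h) + S g - of_nat n * F g h \<in> \<int>"
        by (simp add: sum.distrib sum_subtractf S_def n_def)
      then have "- (S h - S (g \<otimes>\<^bsub>G\<^esub> h) + S g - of_nat n * F g h) \<in> \<int>" by (rule Ints_minus)
      also have "- (S h - S (g \<otimes>\<^bsub>G\<^esub> h) + S g - of_nat n * F g h) = of_nat n * F' g h"
        using n by (simp add: F'_def rat_coboundary_def \<phi>_def field_simps)
      finally show ?thesis .
    qed
    have F': "rat_cocycle G F'"
      unfolding rat_cocycle_def
    proof (intro ballI)
      fix g h k assume *: "g \<in> carrier G" "h \<in> carrier G" "k \<in> carrier G"
      have "F' h k - F' (g \<otimes>\<^bsub>G\<^esub> h) k + F' g (h \<otimes>\<^bsub>G\<^esub> k) - F' g h =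
          F h k - F (g \<otimes>\<^bsub>G\<^esub> h) k + F g (h \<otimes>\<^bsub>G\<^esub> k) - F g h"
        using * by (simp add: F'_def rat_coboundary_def G.m_assoc)
      then show "F' h k - F' (g \<otimes>\<^bsub>G\<^esub> h) k + F' g (h \<otimes>\<^bsub>G\<^esub> k) - F' g h \<in> \<int>"
        using F * by (simp add: rat_cocycle_def)
    qed
    have "F g h - F' g h - rat_coboundary G \<phi> g h = 0" for g h by (simp add: F'_def)
    then have "U = H2_class G F'" unfolding U H2_class_eq_iff[OF F F'] by (intro exI[of _ \<phi>]) simp
    moreover have "rat_cochain G F' \<in> ?C" using inV int by (auto simp: rat_cochain_def)
    ultimately show "U \<in> (\<lambda>f. coboundaries2 G QmodZ #>\<^bsub>cocycles2 G QmodZ\<^esub> f) ` ?C"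
      by (auto simp: H2_class_def)
  qed
  moreover have "finite ?C"
  proof (rule finite_PiE)
    show "finite (carrier G \<times> carrier G)" using fin by simp
    show "finite V" by (simp add: V_def)
  qed
  ultimately show ?thesis using finite_subset by blast
qed

end

lemma H2_class_in_bogomolov:
  assumes G: "Group.group G" and F: "rat_cocycle G F"
    and triv: "\<And>S. subgroup S G \<Longrightarrow> (\<And>a b. a \<in> S \<Longrightarrow> b \<in> S \<Longrightarrow> a \<otimes>\<^bsub>G\<^esub> b = b \<otimes>\<^bsub>G\<^esub> a) \<Longrightarrow>
      \<exists>\<phi>. \<forall>a\<in>S. \<forall>b\<in>S. F a b - rat_coboundary G \<phi> a b \<in> \<int>"
  shows "H2_class G F \<in> bogomolov_multiplier G"
  unfolding bogomolov_multiplier_def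
proof (rule INT_I)
  interpret G: Group.group G by (fact G)
  fix S assume "S \<in> {S. subgroup S G \<and> comm_group (G\<lparr>carrier := S\<rparr>)}"
  then have S: "subgroup S G" and comm: "comm_group (G\<lparr>carrier := S\<rparr>)" by auto
  let ?H = "G\<lparr>carrier := S\<rparr>"
  have H: "Group.group ?H" by (rule G.subgroup_imp_group[OF S])
  interpret ZH: comm_group "cocycles2 ?H QmodZ" by (rule comm_group_cocycles2[OF H comm_group_QmodZ])
  have BH: "subgroup (coboundaries2 ?H QmodZ) (cocycles2 ?H QmodZ)"
    by (rule subgroup_coboundaries2[OF H comm_group_QmodZ])
  have Fc: "rat_cochain G F \<in> carrier (cocycles2 G QmodZ)" using F by (simp add: rat_cochain_cocycle_iff[OF G])
  have "a \<otimes>\<^bsub>G\<^esub> b = b \<otimes>\<^bsub>G\<^esub> a" if "a \<in> S" "b \<in> S" for a b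
    using comm_groupE(4)[OF comm, of a b] that by simp
  then obtain \<phi> where "\<forall>a\<in>S. \<forall>b\<in>S. F a b - rat_coboundary G \<phi> a b \<in> \<int>" using triv[OF S] by blast
  then have "\<forall>a\<in>carrier ?H. \<forall>b\<in>carrier ?H. F a b - rat_coboundary ?H \<phi> a b \<in> \<int>"
    by (simp add: rat_coboundary_def)
  then have "rat_cochain ?H F \<in> coboundaries2 ?H QmodZ"
    using rat_cochain_coboundary_iff[OF H] by blast
  moreover have "restrict (rat_cochain G F) (S \<times> S) = rat_cochain ?H F"
    using subgroup.subset[OF S] by (auto simp: rat_cochain_def fun_eq_iff)
  ultimately have "coboundaries2 ?H QmodZ #>\<^bsub>cocycles2 ?H QmodZ\<^esub> restrict (rat_cochain G F) (S \<times> S) =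
      coboundaries2 ?H QmodZ"
    using ZH.coset_join2[OF _ BH] subgroup.mem_carrier[OF BH] by simp
  then have "res2 G S QmodZ (H2_class G F) = \<one>\<^bsub>H2 ?H QmodZ\<^esub>"
    unfolding H2_class_def res2_class[OF G comm_group_QmodZ S Fc] by (simp add: H2_def)
  moreover have "H2_class G F \<in> carrier (H2 G QmodZ)"
    using Fc by (auto simp: H2_class_def H2_def carrier_FactGroup)
  ultimately show "H2_class G F \<in> kernel (H2 G QmodZ) (H2 ?H QmodZ) (res2 G S QmodZ)"
    by (simp add: kernel_def)
qed

lemma finite_bogomolov_multiplier:
  assumes G: "Group.group G" and fin: "finite (carrier G)"
  shows "finite (bogomolov_multiplier G)"
  by (rule finite_subset[OF subgroup.subset[OF subgroup_bogomolov_multiplier[OF G]] finite_H2_QmodZ[OF G fin]])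


section \<open>A family of unramified classes\<close>

lemma of_int_div_in_Ints_iff:
  "0 < q \<Longrightarrow> rat_of_int a / of_nat q \<in> \<int> \<longleftrightarrow> int q dvd a"
proof
  assume q: "0 < q" and "rat_of_int a / of_nat q \<in> \<int>"
  then obtain b :: int where "rat_of_int a / of_nat q = of_int b" by (auto elim: Ints_cases)
  then have "rat_of_int a = rat_of_int (b * int q)" using q by (simp add: field_simps)
  then have "a = b * int q" by (simp only: of_int_eq_iff)
  then show "int q dvd a" by simp
next
  assume q: "0 < q" and "int q dvd a"
  then obtain b where "a = int q * b" by blast
  then show "rat_of_int a / of_nat q \<in> \<int>" using q by simp
qed

text \<open>
  Two coordinates \<open>x\<close>, \<open>y\<close> modulo \<open>q\<close> give the bilinear cocycles \<open>j x(g) y(h) / q\<close>.  On an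
  abelian subgroup the determinant of any two elements vanishes, so the cocycle is symmetric
  there and is the coboundary of a quadratic form: this is where 2 has to be invertible.
  The classes for different \<open>i\<close>, \<open>j\<close> below \<open>q\<close> are distinct, since the relation
  \<open>[a\<^sub>1, a\<^sub>2] = u = [a\<^sub>4, a\<^sub>3]\<close> forces a cochain that bounds the difference to take, modulo
  \<open>\<int>\<close>, both the value \<open>(j - i)/q\<close> and the value \<open>0\<close> at \<open>u\<close>.
\<close>
lemma card_bogomolov_ge:
  fixes x y :: "'a \<Rightarrow> int" and G :: "('a, 'c) monoid_scheme" (structure)
  assumes G: "Group.group G" and fin: "finite (carrier G)" and q: "0 < q" "odd q"
    and x: "\<And>g h. g \<in> carrier G \<Longrightarrow> h \<in> carrier G \<Longrightarrow> [x (g \<otimes> h) = x g + x h] (mod int q)"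
    and y: "\<And>g h. g \<in> carrier G \<Longrightarrow> h \<in> carrier G \<Longrightarrow> [y (g \<otimes> h) = y g + y h] (mod int q)"
    and comm: "\<And>g h. g \<in> carrier G \<Longrightarrow> h \<in> carrier G \<Longrightarrow> g \<otimes> h = h \<otimes> g \<Longrightarrow>
      int q dvd x g * y h - x h * y g"
    and a: "a1 \<in> carrier G" "a2 \<in> carrier G" "a3 \<in> carrier G" "a4 \<in> carrier G" "u \<in> carrier G"
    and a1: "x a1 = 1" "y a1 = 0" and a2: "x a2 = 0" "y a2 = 1"
    and a34: "x a3 = 0" "x a4 = 0" and u: "x u = 0"
    and rel: "a1 \<otimes> a2 = u \<otimes> (a2 \<otimes> a1)" "a4 \<otimes> a3 = u \<otimes> (a3 \<otimes> a4)"
  shows "q \<le> card (bogomolov_multiplier G)"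
proof -
  interpret Group.group G by (fact G)
  define F where "F j g h = rat_of_int (int j * x g * y h) / of_nat q" for j :: nat and g h
  have cocycle: "rat_cocycle G (F j)" for j
    unfolding rat_cocycle_def
  proof (intro ballI)
    fix g h k assume *: "g \<in> carrier G" "h \<in> carrier G" "k \<in> carrier G"
    have "int q dvd (x g + x h - x (g \<otimes> h)) * (int j * y k) + (int j * x g) * (y (h \<otimes> k) - (y h + y k))"
      using x[of g h] y[of h k] * by (intro dvd_add dvd_mult dvd_mult2) (auto simp: cong_iff_dvd_diff dvd_diff_commute)
    then have "int q dvd int j * x h * y k - int j * x (g \<otimes> h) * y k + int j * x g * y (h \<otimes> k) - int j * x g * y h"
      by (simp add: algebra_simps)
    then show "F j h k - F j (g \<otimes> h) k + F j g (h \<otimes> k) - F j g h \<in> \<int>"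
      using of_int_div_in_Ints_iff[OF q(1)] by (simp add: F_def flip: diff_divide_distrib add_divide_distrib of_int_mult of_int_diff of_int_add)
  qed
  have inB: "H2_class G (F j) \<in> bogomolov_multiplier G" for j
  proof (rule H2_class_in_bogomolov[OF G cocycle])
    fix S assume S: "subgroup S G" and ab: "\<And>a b. a \<in> S \<Longrightarrow> b \<in> S \<Longrightarrow> a \<otimes> b = b \<otimes> a"
    note SG = subgroup.mem_carrier[OF S]
    (* h inverts 2 modulo q, so that \<phi> is half of the quadratic form -j x(g) y(g) / q. *)
    obtain h where h: "2 * h = int q + 1" using q(2) by (metis dvd_def even_Suc of_nat_Suc of_nat_numeral int_ops(7) add.commute)
    define \<phi> where "\<phi> g = - rat_of_int (int j * h * (x g * y g)) / of_nat q" for g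
    show "\<exists>\<phi>. \<forall>a\<in>S. \<forall>b\<in>S. F j a b - rat_coboundary G \<phi> a b \<in> \<int>"
    proof (intro exI[of _ \<phi>] ballI)
      fix a b assume abS: "a \<in> S" "b \<in> S"
      then have abG: "a \<in> carrier G" "b \<in> carrier G" using SG by auto
      have "[x (a \<otimes> b) * y (a \<otimes> b) = (x a + x b) * (y a + y b)] (mod int q)"
        using x y abG by (intro cong_mult)
      then have 1: "int q dvd (x a + x b) * (y a + y b) - x (a \<otimes> b) * y (a \<otimes> b)"
        by (simp add: cong_iff_dvd_diff dvd_diff_commute)
      have 2: "int q dvd x a * y b - x b * y a" by (rule comm[OF abG ab[OF abS]])
      have "x a * y b + h * (x b * y b - x (a \<otimes> b) * y (a \<otimes> b) + x a * y a) =
          h * ((x a + x b) * (y a + y b) - x (a \<otimes> b) * y (a \<otimes> b)) +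
          (h * (x a * y b - x b * y a) - (2 * h - 1) * (x a * y b))"
        by (simp add: algebra_simps)
      moreover have "int q dvd \<dots>" 
        by (rule dvd_add[OF dvd_mult[OF 1] dvd_diff[OF dvd_mult[OF 2] dvd_mult2]]) (simp add: h)
      ultimately have "int q dvd int j * (x a * y b + h * (x b * y b - x (a \<otimes> b) * y (a \<otimes> b) + x a * y a))"
        by simp
      then have "rat_of_int (int j * (x a * y b + h * (x b * y b - x (a \<otimes> b) * y (a \<otimes> b) + x a * y a))) / of_nat q \<in> \<int>"
        by (simp only: of_int_div_in_Ints_iff[OF q(1)])
      also have "rat_of_int (int j * (x a * y b + h * (x b * y b - x (a \<otimes> b) * y (a \<otimes> b) + x a * y a))) / of_nat q =
          F j a b - rat_coboundary G \<phi> a b"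
        using q(1) by (simp add: F_def rat_coboundary_def \<phi>_def field_simps)
      finally show "F j a b - rat_coboundary G \<phi> a b \<in> \<int>" .
    qed
  qed
  have "inj_on (\<lambda>j. H2_class G (F j)) {..<q}"
  proof (rule inj_onI)
    fix i j assume ij: "i \<in> {..<q}" "j \<in> {..<q}" and "H2_class G (F i) = H2_class G (F j)"
    then obtain \<phi> where \<phi>: "\<And>g h. g \<in> carrier G \<Longrightarrow> h \<in> carrier G \<Longrightarrow>
        F i g h - F j g h - rat_coboundary G \<phi> g h \<in> \<int>"
      unfolding H2_class_eq_iff[OF G cocycle cocycle] by blast
    define d where "d = (rat_of_nat i - of_nat j) / of_nat q"
    have F: "F i g h - F j g h = d * of_int (x g * y h)" for g h
      using q(1) by (simp add: F_def d_def diff_divide_distrib algebra_simps)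
    have "d * of_int (x a1 * y a2) - rat_coboundary G \<phi> a1 a2 \<in> \<int>"
      "d * of_int (x a2 * y a1) - rat_coboundary G \<phi> a2 a1 \<in> \<int>"
      "d * of_int (x u * y (a2 \<otimes> a1)) - rat_coboundary G \<phi> u (a2 \<otimes> a1) \<in> \<int>"
      "d * of_int (x a3 * y a4) - rat_coboundary G \<phi> a3 a4 \<in> \<int>"
      "d * of_int (x a4 * y a3) - rat_coboundary G \<phi> a4 a3 \<in> \<int>"
      "d * of_int (x u * y (a3 \<otimes> a4)) - rat_coboundary G \<phi> u (a3 \<otimes> a4) \<in> \<int>"
      using \<phi> a unfolding F by blast+
    note ints = this[unfolded rat_coboundary_def a1 a2 a34 u rel[symmetric], simplified]
    from Ints_diff[OF Ints_diff[OF Ints_diff[OF ints(1,2)] ints(3)]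
        Ints_diff[OF Ints_diff[OF ints(5,4)] ints(6)]]
    have "d \<in> \<int>" by (simp add: algebra_simps)
    then have "rat_of_int (int i - int j) / of_nat q \<in> \<int>" by (simp add: d_def)
    then have "int q dvd int i - int j" by (simp only: of_int_div_in_Ints_iff[OF q(1)])
    then have "[i = j] (mod q)" by (simp add: cong_iff_dvd_diff flip: cong_int_iff)
    then show "i = j" using ij by (simp add: cong_def)
  qed
  then have "card {..<q} \<le> card (bogomolov_multiplier G)"
    using inB finite_bogomolov_multiplier[OF G fin] by (intro card_inj_on_le) auto
  then show ?thesis by simp
qed


section \<open>A direct factor with large Bogomolov multiplier\<close>

text \<open>
  A class two group on four generators in which \<open>[e\<^sub>0, e\<^sub>1] [e\<^sub>2, e\<^sub>3] = 1\<close> is the only relation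
  between the commutators \<open>[e\<^sub>i, e\<^sub>j]\<close>, \<open>i < j\<close>, besides \<open>z\<^sup>N = 1\<close>.  The central coordinates 4 to 7 of
  a commutator \<open>[x, y]\<close> are the Pluecker coordinates \<open>p\<^sub>0\<^sub>2\<close>, \<open>p\<^sub>0\<^sub>3\<close>, \<open>p\<^sub>1\<^sub>2\<close>, \<open>p\<^sub>1\<^sub>3\<close> of the pair, and
  coordinate 8 is \<open>p\<^sub>0\<^sub>1 - p\<^sub>2\<^sub>3\<close>.
\<close>
definition pluecker_coeff :: "nat \<Rightarrow> nat \<Rightarrow> nat \<Rightarrow> int"
  where "pluecker_coeff i j k =
    (if (i, j, k) \<in> {(0, 2, 4), (0, 3, 5), (1, 2, 6), (1, 3, 7), (0, 1, 8)} then 1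
     else if (i, j, k) = (2, 3, 8) then - 1 else 0)"

definition pluecker_group :: "nat \<Rightarrow> (nat \<Rightarrow> int) monoid"
  where "pluecker_group N = class2_group N 4 5 pluecker_coeff"

lemma bil_pluecker:
  "bil 4 pluecker_coeff 4 x y = x 0 * y 2" "bil 4 pluecker_coeff 5 x y = x 0 * y 3"
  "bil 4 pluecker_coeff 6 x y = x 1 * y 2" "bil 4 pluecker_coeff 7 x y = x 1 * y 3"
  "bil 4 pluecker_coeff 8 x y = x 0 * y 1 - x 2 * y 3"
proof -
  have sum4: "(\<Sum>i<4. f i) = f 0 + f 1 + f 2 + f 3" for f :: "nat \<Rightarrow> int"
    by (simp add: eval_nat_numeral)
  show "bil 4 pluecker_coeff 4 x y = x 0 * y 2" "bil 4 pluecker_coeff 5 x y = x 0 * y 3"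
    "bil 4 pluecker_coeff 6 x y = x 1 * y 2" "bil 4 pluecker_coeff 7 x y = x 1 * y 3"
    "bil 4 pluecker_coeff 8 x y = x 0 * y 1 - x 2 * y 3"
    by (simp_all add: bil_def sum4 pluecker_coeff_def)
qed

text \<open>
  The Pluecker relation \<open>p\<^sub>0\<^sub>1 p\<^sub>2\<^sub>3 = p\<^sub>0\<^sub>2 p\<^sub>1\<^sub>3 - p\<^sub>0\<^sub>3 p\<^sub>1\<^sub>2\<close> turns commutation into
  \<open>p\<^sub>0\<^sub>1\<^sup>2 = 0\<close> modulo \<open>q\<^sup>2\<close>.
\<close>
lemma pluecker_commute:
  assumes comm: "x \<otimes>\<^bsub>pluecker_group (q ^ 2)\<^esub> y = y \<otimes>\<^bsub>pluecker_group (q ^ 2)\<^esub> x"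
  shows "int q dvd x 0 * y 1 - y 0 * x 1"
proof -
  have c: "[bil 4 pluecker_coeff k x y = bil 4 pluecker_coeff k y x] (mod int (q ^ 2))" if "k < 9" for k
    using class2_commute_cong[where N = "q ^ 2" and r = 4 and s = 5] comm that by (simp add: pluecker_group_def)
  define P where "P i j = x i * y j - y i * x j" for i j
  have d: "int (q ^ 2) dvd P 0 2" "int (q ^ 2) dvd P 1 2" "int (q ^ 2) dvd P 0 1 - P 2 3"
    using c[of 4] c[of 6] c[of 8] by (simp_all add: bil_pluecker P_def cong_iff_dvd_diff algebra_simps)
  have "int (q ^ 2) dvd P 0 1 * (P 0 1 - P 2 3) + (P 0 2 * P 1 3 - P 0 3 * P 1 2)"
    by (rule dvd_add[OF dvd_mult[OF d(3)] dvd_diff[OF dvd_mult2[OF d(1)] dvd_mult[OF d(2)]]])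
  also have "P 0 1 * (P 0 1 - P 2 3) + (P 0 2 * P 1 3 - P 0 3 * P 1 2) = P 0 1 ^ 2"
    by (simp add: P_def algebra_simps power2_eq_square)
  finally have "int q ^ 2 dvd P 0 1 ^ 2" by simp
  then show ?thesis by (simp add: P_def)
qed

text \<open>
  The cocycles are inflated along the projection \<open>\<pi>\<close> onto the second factor, which sends
  commuting elements to commuting elements, and the section \<open>s\<close> of \<open>\<pi>\<close> provides the relation
  that keeps their classes apart.
\<close>
lemma bogomolov_DirProd_pluecker:
  fixes K :: "('b, 'c) monoid_scheme" and L :: "('a, 'd) monoid_scheme"
  assumes K: "Group.group K" "finite (carrier K)" and L: "Group.group L"
    and q: "1 < q" "odd q" and iso: "L \<times>\<times> pluecker_group (q ^ 2) \<cong> K"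
  shows "q \<le> card (bogomolov_multiplier K)"
proof -
  let ?H = "pluecker_group (q ^ 2)" and ?e = "unit_vec (4 + 5)"
  have N: "1 < q ^ 2" "0 < q ^ 2" using one_less_power[OF q(1), of 2] q(1) by simp_all
  interpret K: Group.group K by (rule K(1))
  interpret L: Group.group L by (rule L)
  interpret H: Group.group ?H unfolding pluecker_group_def by (rule group_class2[OF N(2)])
  have "K \<cong> L \<times>\<times> ?H" using group.iso_sym[OF DirProd_group[OF L H.is_group] iso] .
  then obtain \<theta> where \<theta>: "\<theta> \<in> iso K (L \<times>\<times> ?H)" by (auto simp: is_iso_def)
  define \<pi> where "\<pi> = snd \<circ> \<theta>"
  have \<theta>c: "\<theta> g \<in> carrier L \<times> carrier ?H" if "g \<in> carrier K" for g
    using \<theta> that by (auto simp: iso_def hom_def DirProd_def)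
  have \<theta>m: "\<theta> (g \<otimes>\<^bsub>K\<^esub> h) = \<theta> g \<otimes>\<^bsub>L \<times>\<times> ?H\<^esub> \<theta> h" if "g \<in> carrier K" "h \<in> carrier K" for g h
    using \<theta> that by (simp add: iso_def hom_def)
  have \<pi>m: "\<pi> (g \<otimes>\<^bsub>K\<^esub> h) = \<pi> g \<otimes>\<^bsub>?H\<^esub> \<pi> h" if "g \<in> carrier K" "h \<in> carrier K" for g h
    using \<theta>m[OF that] by (simp add: \<pi>_def DirProd_def case_prod_unfold)
  have coord: "[\<pi> (g \<otimes>\<^bsub>K\<^esub> h) i = \<pi> g i + \<pi> h i] (mod int q)"
    if "g \<in> carrier K" "h \<in> carrier K" "i < 4" for g h i
  proof -
    have "[\<pi> (g \<otimes>\<^bsub>K\<^esub> h) i = \<pi> g i + \<pi> h i] (mod int (q ^ 2))"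
      unfolding \<pi>m[OF that(1,2)] pluecker_group_def by (rule class2_mult_cong_base[OF that(3)])
    then show ?thesis by (rule cong_dvd_modulus) simp
  qed
  define s where "s h = inv_into (carrier K) \<theta> (\<one>\<^bsub>L\<^esub>, h)" for h
  have bij: "bij_betw \<theta> (carrier K) (carrier L \<times> carrier ?H)"
    using \<theta> by (simp add: iso_def DirProd_def)
  have s: "s h \<in> carrier K \<and> \<theta> (s h) = (\<one>\<^bsub>L\<^esub>, h)" if "h \<in> carrier ?H" for h
  proof -
    have "(\<one>\<^bsub>L\<^esub>, h) \<in> \<theta> ` carrier K" using bij that by (simp add: bij_betw_def)
    then show ?thesis unfolding s_def by (simp add: inv_into_into f_inv_into_f)
  qed
  have s\<pi>: "\<pi> (s h) = h" if "h \<in> carrier ?H" for h using s[OF that] by (simp add: \<pi>_def)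
  have sm: "s (h \<otimes>\<^bsub>?H\<^esub> h') = s h \<otimes>\<^bsub>K\<^esub> s h'" if "h \<in> carrier ?H" "h' \<in> carrier ?H" for h h'
  proof -
    have "\<theta> (s (h \<otimes>\<^bsub>?H\<^esub> h')) = \<theta> (s h \<otimes>\<^bsub>K\<^esub> s h')"
      using s that \<theta>m by (simp add: DirProd_def)
    moreover have "inj_on \<theta> (carrier K)" using bij by (simp add: bij_betw_def)
    ultimately show ?thesis using s that by (blast dest: inj_onD)
  qed
  have e: "?e i \<in> carrier ?H" for i
    unfolding pluecker_group_def by (rule unit_vec_in_carrier[OF N(1)])
  have sK: "s (?e i) \<in> carrier K" for i using s e by blast
  have val: "\<pi> (s (?e i)) j = (if j = i then 1 else 0)" if "j < 9" for i j
    using that unfolding s\<pi>[OF e] by (simp add: unit_vec_def)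
  have rel: "?e 0 \<otimes>\<^bsub>?H\<^esub> ?e 1 = ?e 8 \<otimes>\<^bsub>?H\<^esub> (?e 1 \<otimes>\<^bsub>?H\<^esub> ?e 0)"
    unfolding pluecker_group_def
    by (rule class2_unit_vec_swap[OF N(1)])
      (use e[of 8] in \<open>auto simp: pluecker_group_def pluecker_coeff_def unit_vec_def\<close>)
  (* The reversed order of the generators 2 and 3 turns their coefficient -1 into 1. *)
  have rel': "?e 3 \<otimes>\<^bsub>?H\<^esub> ?e 2 = ?e 8 \<otimes>\<^bsub>?H\<^esub> (?e 2 \<otimes>\<^bsub>?H\<^esub> ?e 3)"
  proof (rule class2_eqI[of _ "q ^ 2" 4 5 pluecker_coeff])
    show "?e 3 \<otimes>\<^bsub>?H\<^esub> ?e 2 \<in> carrier (class2_group (q ^ 2) 4 5 pluecker_coeff)"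
      "?e 8 \<otimes>\<^bsub>?H\<^esub> (?e 2 \<otimes>\<^bsub>?H\<^esub> ?e 3) \<in> carrier (class2_group (q ^ 2) 4 5 pluecker_coeff)"
      unfolding pluecker_group_def by (rule class2_closed[OF N(2)])+
    fix k :: nat assume k: "k < 4 + 5"
    have 1: "[(?e 3 \<otimes>\<^bsub>?H\<^esub> ?e 2) k = ?e 3 k + ?e 2 k + bil 4 pluecker_coeff k (?e 3) (?e 2)] (mod int (q ^ 2))"
      unfolding pluecker_group_def by (rule class2_mult_cong[OF k])
    have 2: "[(?e 8 \<otimes>\<^bsub>?H\<^esub> (?e 2 \<otimes>\<^bsub>?H\<^esub> ?e 3)) k =
        ?e 8 k + (?e 2 k + ?e 3 k + bil 4 pluecker_coeff k (?e 2) (?e 3)) + 0] (mod int (q ^ 2))"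
      unfolding pluecker_group_def
      by (rule cong_trans[OF class2_mult_cong[OF k]])
        (intro cong_add cong_refl class2_mult_cong[OF k], simp add: bil_zero_left unit_vec_def)
    have 3: "bil 4 pluecker_coeff k (?e 3) (?e 2) = ?e 8 k + bil 4 pluecker_coeff k (?e 2) (?e 3)"
    proof (cases "k < 4")
      case True
      then show ?thesis by (simp add: bil_def unit_vec_def)
    next
      case False
      then have "bil 4 pluecker_coeff k (?e 3) (?e 2) = pluecker_coeff 3 2 k"
        "bil 4 pluecker_coeff k (?e 2) (?e 3) = pluecker_coeff 2 3 k"
        by (intro bil_unit_vec; simp)+
      moreover have "pluecker_coeff 3 2 k = 0" by (simp add: pluecker_coeff_def)
      moreover have "?e 8 k + pluecker_coeff 2 3 k = 0"
        using k by (simp add: pluecker_coeff_def unit_vec_def)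
      ultimately show ?thesis by simp
    qed
    show "[(?e 3 \<otimes>\<^bsub>?H\<^esub> ?e 2) k = (?e 8 \<otimes>\<^bsub>?H\<^esub> (?e 2 \<otimes>\<^bsub>?H\<^esub> ?e 3)) k] (mod int (q ^ 2))"
    proof -
      have "?e 3 k + ?e 2 k + bil 4 pluecker_coeff k (?e 3) (?e 2) =
          ?e 8 k + (?e 2 k + ?e 3 k + bil 4 pluecker_coeff k (?e 2) (?e 3)) + 0"
        using 3 by linarith
      from cong_trans[OF 1[unfolded this] cong_sym[OF 2]] show ?thesis .
    qed
  qed
  show ?thesis
  proof (rule card_bogomolov_ge[OF K, where x = "\<lambda>g. \<pi> g 0" and y = "\<lambda>g. \<pi> g 1"])
    fix g h assume gh: "g \<in> carrier K" "h \<in> carrier K" and "g \<otimes>\<^bsub>K\<^esub> h = h \<otimes>\<^bsub>K\<^esub> g"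
    then have "\<pi> g \<otimes>\<^bsub>?H\<^esub> \<pi> h = \<pi> h \<otimes>\<^bsub>?H\<^esub> \<pi> g" using \<pi>m by metis
    then show "int q dvd \<pi> g 0 * \<pi> h 1 - \<pi> h 0 * \<pi> g 1" by (rule pluecker_commute)
  next
    show "s (?e 0) \<otimes>\<^bsub>K\<^esub> s (?e 1) = s (?e 8) \<otimes>\<^bsub>K\<^esub> (s (?e 1) \<otimes>\<^bsub>K\<^esub> s (?e 0))"
      using arg_cong[OF rel, of s] e sm by simp
    show "s (?e 3) \<otimes>\<^bsub>K\<^esub> s (?e 2) = s (?e 8) \<otimes>\<^bsub>K\<^esub> (s (?e 2) \<otimes>\<^bsub>K\<^esub> s (?e 3))"
      using arg_cong[OF rel', of s] e sm by simp
  qed (use q coord sK val in simp_all)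
qed

text \<open>
  The isomorphism is \<open>G \<rightarrow> K \<rightarrow> G' \<times> H \<rightarrow> G'\<close>.  It is injective because an element of its kernel has
  the same image in \<open>K\<close> as some element of \<open>H\<close>, and the two embeddings of \<open>H\<close> agree; bijectivity
  then follows by counting.
\<close>
lemma iso_if_DirProd_iso:
  assumes G: "Group.group G" and G': "Group.group G'" and H: "Group.group H" and K: "Group.group K"
    and fin: "finite (carrier G')" "finite (carrier H)"
    and \<psi>: "\<psi> \<in> iso (G \<times>\<times> H) K" and \<psi>': "\<psi>' \<in> iso (G' \<times>\<times> H) K"
    and eq: "\<And>h. h \<in> carrier H \<Longrightarrow> \<psi> (\<one>\<^bsub>G\<^esub>, h) = \<psi>' (\<one>\<^bsub>G'\<^esub>, h)"
  shows "G \<cong> G'"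
proof -
  interpret G: Group.group G by (fact G)
  interpret G': Group.group G' by (fact G')
  interpret H: Group.group H by (fact H)
  define \<sigma> where "\<sigma> = inv_into (carrier (G' \<times>\<times> H)) \<psi>'"
  have \<sigma>: "\<sigma> \<in> iso K (G' \<times>\<times> H)"
    unfolding \<sigma>_def by (rule group.iso_set_sym[OF DirProd_group[OF G' H] \<psi>'])
  define f where "f g = fst (\<sigma> (\<psi> (g, \<one>\<^bsub>H\<^esub>)))" for g
  have \<sigma>\<psi>: "\<sigma> \<circ> \<psi> \<in> hom (G \<times>\<times> H) (G' \<times>\<times> H)"
    using \<sigma> \<psi> by (auto simp: iso_def intro: hom_compose)
  have f: "f \<in> hom G G'"
  proof (rule homI)
    fix x y assume xy: "x \<in> carrier G" "y \<in> carrier G"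
    then have mem: "(x, \<one>\<^bsub>H\<^esub>) \<in> carrier (G \<times>\<times> H)" "(y, \<one>\<^bsub>H\<^esub>) \<in> carrier (G \<times>\<times> H)" by auto
    from hom_in_carrier[OF \<sigma>\<psi> mem(1)] show "f x \<in> carrier G'" by (auto simp: f_def DirProd_def)
    from hom_mult[OF \<sigma>\<psi> mem] show "f (x \<otimes>\<^bsub>G\<^esub> y) = f x \<otimes>\<^bsub>G'\<^esub> f y"
      by (simp add: f_def DirProd_def case_prod_unfold)
  qed
  interpret f: group_hom G G' f using G G' f by (simp add: group_hom_def group_hom_axioms_def)
  have "inj_on f (carrier G)"
  proof (unfold f.inj_on_one_iff, intro allI impI)
    fix g assume g: "g \<in> carrier G" and "f g = \<one>\<^bsub>G'\<^esub>"
    define h where "h = snd (\<sigma> (\<psi> (g, \<one>\<^bsub>H\<^esub>)))"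
    have pair: "\<sigma> (\<psi> (g, \<one>\<^bsub>H\<^esub>)) = (\<one>\<^bsub>G'\<^esub>, h)" using \<open>f g = \<one>\<^bsub>G'\<^esub>\<close> by (simp add: f_def h_def prod_eq_iff)
    have gH: "(g, \<one>\<^bsub>H\<^esub>) \<in> carrier (G \<times>\<times> H)" using g by simp
    from hom_in_carrier[OF \<sigma>\<psi> gH] have h: "h \<in> carrier H" by (simp add: pair)
    have "\<psi> (g, \<one>\<^bsub>H\<^esub>) \<in> carrier K" using \<psi> gH by (auto simp: iso_def hom_def)
    then have "\<psi> (g, \<one>\<^bsub>H\<^esub>) = \<psi>' (\<sigma> (\<psi> (g, \<one>\<^bsub>H\<^esub>)))"
      using \<psi>' bij_betw_inv_into_right[of \<psi>' "carrier (G' \<times>\<times> H)" "carrier K"] by (simp add: \<sigma>_def iso_def)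
    also have "\<dots> = \<psi> (\<one>\<^bsub>G\<^esub>, h)" using pair eq[OF h] by simp
    finally have "(g, \<one>\<^bsub>H\<^esub>) = (\<one>\<^bsub>G\<^esub>, h)"
      using \<psi> gH h by (auto simp: iso_def bij_betw_def inj_on_eq_iff)
    then show "g = \<one>\<^bsub>G\<^esub>" by simp
  qed
  moreover have "card (carrier G) = card (carrier G')"
  proof -
    have "card (carrier G \<times> carrier H) = card (carrier G' \<times> carrier H)"
      using bij_betw_same_card[of \<psi> "carrier (G \<times>\<times> H)" "carrier K"]
        bij_betw_same_card[of \<psi>' "carrier (G' \<times>\<times> H)" "carrier K"] \<psi> \<psi>' by (simp add: iso_def)
    moreover have "card (carrier H) \<noteq> 0" using fin H.one_closed by auto
    ultimately show ?thesis by (simp add: card_cartesian_product)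
  qed
  moreover have "f ` carrier G \<subseteq> carrier G'" by auto
  ultimately have "bij_betw f (carrier G) (carrier G')"
    unfolding bij_betw_def using card_subset_eq[OF fin(1)] by (metis card_image)
  then show ?thesis using f by (intro is_isoI[of f]) (simp add: iso_def)
qed


section \<open>Comparison of the two counts\<close>

lemma num_B0_ge_le_num_all:
  assumes p: "Factorial_Ring.prime (p::nat)"
  shows "finite ({G \<in> groups_of_order (p ^ n). card (bogomolov_multiplier G) \<ge> M} //
      iso_rel {G \<in> groups_of_order (p ^ n). card (bogomolov_multiplier G) \<ge> M})"
    and "num_B0_ge p M n \<le> num_all p n"
proof -
  let ?\<G> = "{G \<in> groups_of_order (p ^ n). card (bogomolov_multiplier G) \<ge> M}"
  let ?\<H> = "groups_of_order (p ^ n)"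
  have "finite (?\<G> // iso_rel ?\<G>) \<and> num_iso_classes ?\<G> \<le> num_iso_classes ?\<H> * 1"
  proof (rule num_iso_classes_le[where D = "\<lambda>_. {()}" and P = "\<lambda>K _ G. K \<cong> G"])
    fix G assume "G \<in> ?\<G>"
    then have G: "G \<in> ?\<H>" by simp
    show "\<exists>K\<in>?\<H>. \<forall>K'\<in>?\<H>. K \<cong> K' \<longrightarrow> (\<exists>d\<in>{()}. K' \<cong> G)"
      using G group.iso_sym[OF groups_of_orderD(1)[OF G]] by blast
  next
    fix K d G G' assume K: "K \<in> ?\<H>" and "K \<cong> G" "K \<cong> G'"
    then show "G \<cong> G'" using group.iso_sym[OF groups_of_orderD(1)[OF K]] iso_trans by blast
  qed (use finite_iso_classes[OF p] groups_of_orderD in auto)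
  then show "finite (?\<G> // iso_rel ?\<G>)" "num_B0_ge p M n \<le> num_all p n"
    by (simp_all add: num_B0_ge_def num_all_def)
qed

text \<open>
  Multiplying by a fixed \<open>p\<close>-group whose Bogomolov multiplier has at least \<open>p ^ M \<ge> M\<close>
  elements; a product arises from at most as many groups as the fixed factor has maps into it.
  The fixed factor has nine coordinates modulo \<open>p ^ (2 * M)\<close>, hence order \<open>p ^ (18 * M)\<close>.
\<close>
lemma num_all_le_num_B0_ge:
  assumes p: "Factorial_Ring.prime (p::nat)" "2 < p" and M: "0 < M"
  shows "num_all p n \<le> num_B0_ge p M (n + 18 * M) * (p ^ (n + 18 * M)) ^ (p ^ (18 * M))"
proof -
  define q where "q = p ^ M"
  define c where "c = 18 * M"
  let ?H = "pluecker_group (q ^ 2)"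
  have p1: "1 < p" and p0: "0 < p" using p(2) by auto
  have q: "1 < q" "odd q" "M \<le> q"
    unfolding q_def using one_less_power[OF p1 M] prime_odd_nat[OF p] less_exp[of M]
      power_mono[of 2 p M] p(2) by auto
  have N: "0 < q ^ 2" using q(1) by simp
  have H: "Group.group ?H" unfolding pluecker_group_def by (rule group_class2[OF N])
  have finH: "finite (carrier ?H)" unfolding pluecker_group_def by (rule finite_class2)
  have cardH: "card (carrier ?H) = p ^ c"
    using order_class2[of "q ^ 2" 4 5 pluecker_coeff]
    by (simp add: pluecker_group_def order_def q_def c_def flip: power_mult)
  let ?\<G> = "groups_of_order (p ^ n)"
  let ?\<H> = "{G \<in> groups_of_order (p ^ (n + c)). card (bogomolov_multiplier G) \<ge> M}"
  let ?P = "\<lambda>K d G. \<exists>\<psi>\<in>iso (G \<times>\<times> ?H) K. \<forall>h\<in>carrier ?H. d h = \<psi> (\<one>\<^bsub>G\<^esub>, h)"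
  have "finite (?\<G> // iso_rel ?\<G>) \<and>
    num_iso_classes ?\<G> \<le> num_iso_classes ?\<H> * (p ^ (n + c)) ^ (p ^ c)"
  proof (rule num_iso_classes_le[where D = "\<lambda>K. carrier ?H \<rightarrow>\<^sub>E carrier K" and P = ?P])
    show "finite (?\<H> // iso_rel ?\<H>)" by (rule num_B0_ge_le_num_all(1)[OF p(1)])
  next
    fix K assume "K \<in> ?\<H>"
    then have "K \<in> groups_of_order (p ^ (n + c))" by simp
    from groups_of_orderD[OF this] show "finite (carrier ?H \<rightarrow>\<^sub>E carrier K) \<and>
        card (carrier ?H \<rightarrow>\<^sub>E carrier K) \<le> (p ^ (n + c)) ^ (p ^ c)"
      using finH cardH by (simp add: card_PiE finite_PiE)
  next
    fix G assume "G \<in> ?\<G>"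
    note G = groups_of_orderD[OF this]
    have GH: "Group.group (G \<times>\<times> ?H)" by (rule DirProd_group[OF G(1) H])
    have "finite (carrier (G \<times>\<times> ?H))" using G(2) finH by simp
    moreover have "order (G \<times>\<times> ?H) = p ^ (n + c)"
      using G(3) cardH by (simp add: order_def card_cartesian_product power_add)
    ultimately obtain K where K: "K \<in> groups_of_order (p ^ (n + c))" and iso: "G \<times>\<times> ?H \<cong> K"
      using finite_group_iso_nat[OF GH] by auto
    have "q \<le> card (bogomolov_multiplier K)"
      by (rule bogomolov_DirProd_pluecker[OF groups_of_orderD(1,2)[OF K] G(1) q(1,2) iso])
    then have KH: "K \<in> ?\<H>" using K q(3) by simp
    show "\<exists>K\<in>?\<H>. \<forall>K'\<in>?\<H>. K \<cong> K' \<longrightarrow> (\<exists>d\<in>carrier ?H \<rightarrow>\<^sub>E carrier K'. ?P K' d G)"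
    proof (intro bexI[OF _ KH] ballI impI)
      fix K' assume "K' \<in> ?\<H>" "K \<cong> K'"
      then have "G \<times>\<times> ?H \<cong> K'" using iso iso_trans by blast
      then obtain \<psi> where \<psi>: "\<psi> \<in> iso (G \<times>\<times> ?H) K'" by (auto simp: is_iso_def)
      let ?d = "\<lambda>h\<in>carrier ?H. \<psi> (\<one>\<^bsub>G\<^esub>, h)"
      have "\<psi> (\<one>\<^bsub>G\<^esub>, h) \<in> carrier K'" if "h \<in> carrier ?H" for h
        using \<psi> that group.is_monoid[OF G(1)] by (auto simp: iso_def hom_def)
      then have "?d \<in> carrier ?H \<rightarrow>\<^sub>E carrier K'" by simp
      moreover have "?P K' ?d G" using \<psi> by (intro bexI[of _ \<psi>]) simp_all
      ultimately show "\<exists>d\<in>carrier ?H \<rightarrow>\<^sub>E carrier K'. ?P K' d G" by (intro bexI[of _ ?d])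
    qed
  next
    fix K d G G'
    assume K: "K \<in> ?\<H>" and G: "G \<in> ?\<G>" "G' \<in> ?\<G>" and "?P K d G" "?P K d G'"
    then obtain \<psi> \<psi>' where \<psi>: "\<psi> \<in> iso (G \<times>\<times> ?H) K" "\<psi>' \<in> iso (G' \<times>\<times> ?H) K"
      and "\<And>h. h \<in> carrier ?H \<Longrightarrow> \<psi> (\<one>\<^bsub>G\<^esub>, h) = \<psi>' (\<one>\<^bsub>G'\<^esub>, h)" by auto
    moreover have "Group.group K" using K groups_of_orderD(1) by blast
    ultimately show "G \<cong> G'"
      using iso_if_DirProd_iso[OF groups_of_orderD(1)[OF G(1)] groups_of_orderD(1)[OF G(2)] H _
          groups_of_orderD(2)[OF G(2)] finH \<psi>] by blast
  qed (use groups_of_orderD in auto)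
  then show ?thesis by (simp add: num_all_def num_B0_ge_def c_def)
qed

lemma log_le_log_mult_power:
  assumes p: "1 < p" and a: "0 < a" and le: "a \<le> b * p ^ e"
  shows "0 < b" "log (real p) (real a) \<le> log (real p) (real b) + real e"
proof -
  show b: "0 < b" using a le by (cases b) auto
  have "log (real p) (real a) \<le> log (real p) (real (b * p ^ e))"
    using p a of_nat_mono[OF le, where ?'a = real] by (intro log_mono) simp_all
  also have "\<dots> = log (real p) (real b) + real e"
    using p b by (simp add: log_mult log_nat_power)
  finally show "log (real p) (real a) \<le> log (real p) (real b) + real e" .
qed

lemma num_all_pos:
  assumes p: "Factorial_Ring.prime (p::nat)"
  shows "0 < num_all p n"
  using num_all_lower_bound[OF p, of 0 n] by (cases "num_all p n") auto

lemma log_num_all_add_le: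
  assumes p: "Factorial_Ring.prime (p::nat)"
  shows "log p (num_all p (n + k)) \<le> log p (num_all p n) + real (k * p ^ 2 * (n + k) ^ 2)"
proof (induction k)
  case (Suc k)
  have p1: "1 < p" using p prime_gt_1_nat by blast
  have "num_all p (Suc (n + k)) \<le> num_all p (n + k) * p ^ (Suc (n + k) * ((p * (n + k) + p) * p))"
    using num_all_Suc_le[OF p finite_iso_classes[OF p], of "n + k"] by (simp only: power_mult)
  from log_le_log_mult_power(2)[OF p1 num_all_pos[OF p] this]
  have "log p (num_all p (n + Suc k)) \<le>
      log p (num_all p (n + k)) + real (Suc (n + k) * ((p * (n + k) + p) * p))" by simp
  also have "\<dots> \<le> log p (num_all p n) +
      real (k * p ^ 2 * (n + k) ^ 2 + Suc (n + k) * ((p * (n + k) + p) * p))"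
    using Suc by simp
  also have "k * p ^ 2 * (n + k) ^ 2 + Suc (n + k) * ((p * (n + k) + p) * p) \<le>
      Suc k * p ^ 2 * (n + Suc k) ^ 2"
  proof -
    have "k * p ^ 2 * (n + k) ^ 2 \<le> k * p ^ 2 * (n + Suc k) ^ 2" by (intro mult_left_mono power_mono) auto
    moreover have "Suc (n + k) * ((p * (n + k) + p) * p) = p ^ 2 * (n + Suc k) ^ 2"
      by (simp add: power2_eq_square algebra_simps)
    ultimately show ?thesis by (simp add: algebra_simps)
  qed
  finally show ?case by simp
qed simp

text \<open>
  The lower bound is used with \<open>a = n div 3\<close>.  Then \<open>n \<le> 5 * a\<close> gives an exponent of at least
  \<open>n\<^sup>3 / 125\<close>, and the overcounting costs at most half of it.
\<close>
lemma log_num_all_ge_cube: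
  assumes p: "Factorial_Ring.prime (p::nat)" and n: "250 * p \<le> n"
  shows "real n ^ 3 / 250 \<le> log p (num_all p n)"
proof -
  have p1: "1 < p" using p prime_gt_1_nat by blast
  define a where "a = n div 3"
  define s where "s = n - 2 * a"
  have ns: "n = 2 * a + s" and as: "a \<le> s" and na: "n \<le> 5 * a" using n p1 by (auto simp: a_def s_def)
  have "p ^ (a * a * s) \<le> num_all p n * p ^ (n * (p * n))"
    using num_all_lower_bound[OF p, of a s] by (simp add: ns power_mult)
  from log_le_log_mult_power(2)[OF p1 _ this] have
    "real (a * a * s) \<le> log p (num_all p n) + real (n * (p * n))"
    using p1 by (simp add: log_nat_power)
  moreover have "real n ^ 3 / 125 \<le> real (a * a * s)"
  proof -
    have "n ^ 3 \<le> (5 * a) ^ 3" using na by (rule power_mono) simp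
    also have "\<dots> = 125 * (a * a * a)" by (simp add: power3_eq_cube)
    also have "\<dots> \<le> 125 * (a * a * s)" using as by simp
    finally have "real (n ^ 3) \<le> real (125 * (a * a * s))" by (rule of_nat_mono)
    then show ?thesis by simp
  qed
  moreover have "real (n * (p * n)) \<le> real n ^ 3 / 250"
  proof -
    have "250 * (n * (p * n)) = (250 * p) * n ^ 2" by (simp add: power2_eq_square)
    also have "\<dots> \<le> n * n ^ 2" using n by (intro mult_right_mono) auto
    finally have "real (250 * (n * (p * n))) \<le> real (n * n ^ 2)" by (rule of_nat_mono)
    then show ?thesis by (simp add: power3_eq_cube power2_eq_square)
  qed
  ultimately show ?thesis by linarith
qed

theorem mainTheorem1:
  fixes p M :: nat
  assumes "Factorial_Ring.prime p" and "p > 2" and "M > 0"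
  shows "(\<lambda>n. log (real p) (real (num_B0_ge p M n)) / log (real p) (real (num_all p n)))
           \<longlonglongrightarrow> 1"
proof -
  note p = assms(1)
  have p1: "1 < p" using assms(2) by simp
  define c where "c = 18 * M"
  define E where "E = c * p ^ 2 + p ^ c"
  define A where "A n = log p (num_all p n)" for n
  define B where "B n = log p (num_B0_ge p M n)" for n
  have lower: "A m - real (E * m ^ 2) \<le> B m" and upper: "B m \<le> A m" if m: "c \<le> m" "1 \<le> m" for m
  proof -
    obtain n where n: "m = n + c" using m(1) by (metis le_add_diff_inverse2)
    have "num_all p n \<le> num_B0_ge p M m * p ^ (m * p ^ c)"
      using num_all_le_num_B0_ge[OF assms, of n] by (simp add: n c_def power_mult)
    note * = log_le_log_mult_power[OF p1 num_all_pos[OF p] this]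
    have "A m \<le> A n + real (c * p ^ 2 * m ^ 2)"
      using log_num_all_add_le[OF p, of n c] by (simp add: A_def n)
    also have "\<dots> \<le> B m + real (m * p ^ c + c * p ^ 2 * m ^ 2)"
      using *(2) by (simp add: A_def B_def)
    also have "m * p ^ c + c * p ^ 2 * m ^ 2 \<le> E * m ^ 2"
      using m(2) by (simp add: E_def power2_eq_square algebra_simps)
    finally show "A m - real (E * m ^ 2) \<le> B m" by simp
    show "B m \<le> A m"
      unfolding A_def B_def using p1 *(1) num_B0_ge_le_num_all(2)[OF p] by (intro log_mono) auto
  qed
  have bounds: "1 - 250 * real E / real m \<le> B m / A m \<and> B m / A m \<le> 1"
    if m: "c + 250 * p \<le> m" for m
  proof -
    have m0: "0 < real m" using m p1 by simp
    have cube: "real m ^ 3 / 250 \<le> A m" using log_num_all_ge_cube[OF p, of m] m by (simp add: A_def)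
    then have A: "0 < A m" using m0 by (smt (verit) divide_pos_pos zero_less_power)
    have "real (E * m ^ 2) = 250 * real E / real m * (real m ^ 3 / 250)"
      using m0 by (simp add: power3_eq_cube power2_eq_square)
    also have "\<dots> \<le> 250 * real E / real m * A m" using cube by (intro mult_left_mono) auto
    finally have "(1 - 250 * real E / real m) * A m \<le> B m"
      using lower[of m] m p1 by (simp add: algebra_simps)
    then show ?thesis using A upper[of m] m p1 by (simp add: le_divide_eq divide_le_eq)
  qed
  have "(\<lambda>m. B m / A m) \<longlonglongrightarrow> 1"
  proof (rule tendsto_sandwich)
    show "\<forall>\<^sub>F m in sequentially. 1 - 250 * real E / real m \<le> B m / A m"
      using bounds by (auto intro: eventually_sequentiallyI[of "c + 250 * p"])
    show "\<forall>\<^sub>F m in sequentially. B m / A m \<le> 1"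
      using bounds by (auto intro: eventually_sequentiallyI[of "c + 250 * p"])
    show "(\<lambda>m. 1 - 250 * real E / real m) \<longlonglongrightarrow> 1"
      using tendsto_diff[OF tendsto_const lim_const_over_n[of "250 * real E"], of 1] by simp
  qed simp
  then show ?thesis by (simp add: A_def B_def)
qed

end
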